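(* Let $\star$ be any state over time function that satisfies the classical limit axiom. Let $\mathcal{E}:\mathbb{M}_m\to\mathbb{M}_n$ be a bistochastic channel, i.e. a CPTP map that is unital, $\mathcal{E}(1_m)=1_n$, and let $\rho=\frac{1}{m}1_m$ be the uniform density matrix. Then $(\mathcal{E},\rho)$ has a unique Bayesian inverse with respect to $\star$, and it is the Hilbert–Schmidt adjoint of $\mathcal{E}$: $$\mathcal{E}^{\star}_{\rho}=\mathcal{E}^*.$$
   Context: $\mathbb{M}_d$ denotes the algebra of $d\times d$ complex matrices with unit $1_d$. A multi-matrix algebra is a finite direct sum $\mathcal{A}=\bigoplus_{x\in X}\mathbb{M}_{m_x}$ of complex matrix algebras ($X$ a finite set, $m_x$ positive integers), with componentwise multiplication and componentwise conjugate transpose $\dagger$; $1_{\mathcal{A}}$ is its unit and $\mathrm{tr}(A)=\sum_x\mathrm{tr}(A_x)$ its (un-normalized) trace. A state (density matrix) is a positive element of trace $1$; $\mathcal{S}(\mathcal{A})$ is the set of states. $\mathrm{CPTP}(\mathcal{A},\mathcal{B})$ is the set of completely positive trace-preserving linear maps $\mathcal{A}\to\mathcal{B}$. The Hilbert–Schmidt adjoint $\Phi^*:\mathcal{B}\to\mathcal{A}$ of a linear map $\Phi:\mathcal{A}\to\mathcal{B}$ is defined by $\mathrm{tr}(\Phi(A)^{\dagger}B)=\mathrm{tr}(A^{\dagger}\Phi^*(B))$. Let $\mu_{\mathcal{A}}:\mathcal{A}\otimes\mathcal{A}\to\mathcal{A}$ be the multiplication map $A_1\otimes A_2\mapsto A_1A_2$.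 The channel state of a linear map $\Phi:\mathcal{A}\to\mathcal{B}$ is $\mathscr{D}[\Phi]=(\mathrm{id}_{\mathcal{A}}\otimes\Phi)(\mu_{\mathcal{A}}^*(1_{\mathcal{A}}))\in\mathcal{A}\otimes\mathcal{B}$. A state over time function $\star$ associates to every pair $(\mathcal{A},\mathcal{B})$ of multi-matrix algebras a map $\mathrm{CPTP}(\mathcal{A},\mathcal{B})\times\mathcal{S}(\mathcal{A})\to\mathcal{A}\otimes\mathcal{B}$, $(\Phi,\rho)\mapsto\Phi\star\rho$, such that $\mathrm{tr}_{\mathcal{B}}(\Phi\star\rho)=\rho$ and $\mathrm{tr}_{\mathcal{A}}(\Phi\star\rho)=\Phi(\rho)$, where $\mathrm{tr}_{\mathcal{B}}:\mathcal{A}\otimes\mathcal{B}\to\mathcal{A}$ and $\mathrm{tr}_{\mathcal{A}}:\mathcal{A}\otimes\mathcal{B}\to\mathcal{B}$ are the partial traces. It satisfies the classical limit axiom iff, for all multi-matrix algebras $\mathcal{A},\mathcal{B}$, all $\rho\in\mathcal{S}(\mathcal{A})$ and all $\Phi\in\mathrm{CPTP}(\mathcal{A},\mathcal{B})$, the condition $[\mathscr{D}[\Phi],\rho\otimes 1_{\mathcal{B}}]=0$ implies $\Phi\star\rho=\mathscr{D}[\Phi](\rho\otimes 1_{\mathcal{B}})$. A Bayesian inverse of $(\Phi,\rho)$, with $\Phi\in\mathrm{CPTP}(\mathcal{A},\mathcal{B})$ and $\rho\in\mathcal{S}(\mathcal{A})$, with respect to $\star$ is a CPTP map $\Phi^{\star}_{\rho}:\mathcal{B}\to\mathcal{A}$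 such that $\Phi\star\rho=\tau(\Phi^{\star}_{\rho}\star\Phi(\rho))$, where $\tau:\mathcal{B}\otimes\mathcal{A}\to\mathcal{A}\otimes\mathcal{B}$ is the unique conjugate-linear map with $\tau(B\otimes A)=A^{\dagger}\otimes B^{\dagger}$. *)

theory Defs
  imports "Jordan_Normal_Form.Schur_Decomposition" "HOL-Library.FuncSet"
begin

section \<open>Multi-matrix algebras\<close>

text \<open>
  The algebra \<open>\<Oplus>\<^sub>x M\<^bsub>m_x\<^esub>\<close> is encoded by the list \<open>ms\<close> of its block sizes (the finite
  index set \<open>X\<close> is \<open>{0..<length ms}\<close>), and an element by the list of its blocks.  The full matrix
  algebra \<open>M\<^sub>d\<close> is \<open>[d]\<close>.
\<close>

type_synonym algebra = "nat list"
type_synonym elem = "complex mat list"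

definition multi_matrix :: "algebra \<Rightarrow> bool" where
  "multi_matrix ms \<longleftrightarrow> (\<forall>m\<in>set ms. 0 < m)"

definition elems :: "algebra \<Rightarrow> elem set" where
  "elems ms = {As. list_all2 (\<lambda>A m. A \<in> carrier_mat m m) As ms}"

definition mm_one :: "algebra \<Rightarrow> elem" where
  "mm_one ms = map 1\<^sub>m ms"

definition mm_add :: "elem \<Rightarrow> elem \<Rightarrow> elem" where
  "mm_add As Bs = map2 (+) As Bs"

definition mm_scale :: "complex \<Rightarrow> elem \<Rightarrow> elem" where
  "mm_scale c As = map (\<lambda>A. c \<cdot>\<^sub>m A) As"

definition mm_mult :: "elem \<Rightarrow> elem \<Rightarrow> elem" where
  "mm_mult As Bs = map2 (*) As Bs"

definition mm_dagger :: "elem \<Rightarrow> elem" where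
  "mm_dagger As = map mat_adjoint As"

definition mat_trace :: "complex mat \<Rightarrow> complex" where
  "mat_trace A = (\<Sum>i<dim_row A. A $$ (i, i))"

definition mm_trace :: "elem \<Rightarrow> complex" where
  "mm_trace As = (\<Sum>A\<leftarrow>As. mat_trace A)"

definition mm_positive :: "algebra \<Rightarrow> elem \<Rightarrow> bool" where
  "mm_positive ms A \<longleftrightarrow> (\<exists>B\<in>elems ms. A = mm_mult (mm_dagger B) B)"

definition states :: "algebra \<Rightarrow> elem set" where
  "states ms = {\<rho> \<in> elems ms. mm_positive ms \<rho> \<and> mm_trace \<rho> = 1}"

section \<open>Tensor products\<close>

text \<open>
  \<open>M\<^sub>m \<otimes> M\<^sub>n\<close> is identified with \<open>M\<^bsub>mn\<^esub>\<close> by the Kronecker product, and the blocks of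
  \<open>\<A> \<otimes> \<B>\<close>, indexed by \<open>X \<times> Y\<close>, are listed lexicographically.
\<close>

definition kronecker :: "complex mat \<Rightarrow> complex mat \<Rightarrow> complex mat" where
  "kronecker A B = mat (dim_row A * dim_row B) (dim_col A * dim_col B)
     (\<lambda>(i, j). A $$ (i div dim_row B, j div dim_col B) * B $$ (i mod dim_row B, j mod dim_col B))"

definition alg_tensor :: "algebra \<Rightarrow> algebra \<Rightarrow> algebra" where
  "alg_tensor ms ns = map (\<lambda>(m, n). m * n) (List.product ms ns)"

definition mm_tensor :: "elem \<Rightarrow> elem \<Rightarrow> elem" where
  "mm_tensor As Bs = map (\<lambda>(A, B). kronecker A B) (List.product As Bs)"

section \<open>Linear and conjugate-linear maps\<close>

text \<open>
  Maps are extensional (\<open>undefined\<close> off their domain), so that equality of maps is HOL equality.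
  The scalar twist \<open>\<sigma>\<close> is the identity for linear maps and \<open>cnj\<close> for conjugate-linear maps.
\<close>

definition semilinear_maps :: "(complex \<Rightarrow> complex) \<Rightarrow> algebra \<Rightarrow> algebra \<Rightarrow> (elem \<Rightarrow> elem) set" where
  "semilinear_maps \<sigma> ms ns = {T \<in> elems ms \<rightarrow>\<^sub>E elems ns.
     (\<forall>A\<in>elems ms. \<forall>B\<in>elems ms. T (mm_add A B) = mm_add (T A) (T B)) \<and>
     (\<forall>c. \<forall>A\<in>elems ms. T (mm_scale c A) = mm_scale (\<sigma> c) (T A))}"

abbreviation linear_maps :: "algebra \<Rightarrow> algebra \<Rightarrow> (elem \<Rightarrow> elem) set" where
  "linear_maps \<equiv> semilinear_maps (\<lambda>c. c)"

text \<open>The unique \<open>\<sigma>\<close>-linear map \<open>T : \<A> \<otimes> \<B> \<rightarrow> \<C>\<close> with \<open>T (A \<otimes> B) = f A B\<close>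
  (for \<open>f\<close> that is \<open>\<sigma>\<close>-linear in each argument).\<close>

definition tensor_ext ::
  "(complex \<Rightarrow> complex) \<Rightarrow> algebra \<Rightarrow> algebra \<Rightarrow> algebra \<Rightarrow> (elem \<Rightarrow> elem \<Rightarrow> elem) \<Rightarrow> elem \<Rightarrow> elem" where
  "tensor_ext \<sigma> ms ns ks f =
     (THE T. T \<in> semilinear_maps \<sigma> (alg_tensor ms ns) ks \<and>
             (\<forall>A\<in>elems ms. \<forall>B\<in>elems ns. T (mm_tensor A B) = f A B))"

text \<open>\<open>F \<otimes> G : \<A> \<otimes> \<B> \<rightarrow> \<A>' \<otimes> \<B>'\<close> for linear \<open>F : \<A> \<rightarrow> \<A>'\<close> and \<open>G : \<B> \<rightarrow> \<B>'\<close>.\<close>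

definition map_tensor ::
  "algebra \<Rightarrow> algebra \<Rightarrow> algebra \<Rightarrow> algebra \<Rightarrow> (elem \<Rightarrow> elem) \<Rightarrow> (elem \<Rightarrow> elem) \<Rightarrow> elem \<Rightarrow> elem" where
  "map_tensor ms ns ms' ns' F G =
     tensor_ext (\<lambda>c. c) ms ns (alg_tensor ms' ns') (\<lambda>A B. mm_tensor (F A) (G B))"

definition ptrace_snd :: "algebra \<Rightarrow> algebra \<Rightarrow> elem \<Rightarrow> elem" where
  "ptrace_snd ms ns = tensor_ext (\<lambda>c. c) ms ns ms (\<lambda>A B. mm_scale (mm_trace B) A)"

definition ptrace_fst :: "algebra \<Rightarrow> algebra \<Rightarrow> elem \<Rightarrow> elem" where
  "ptrace_fst ms ns = tensor_ext (\<lambda>c. c) ms ns ns (\<lambda>A B. mm_scale (mm_trace A) B)"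

definition mult_map :: "algebra \<Rightarrow> elem \<Rightarrow> elem" where
  "mult_map ms = tensor_ext (\<lambda>c. c) ms ms ms mm_mult"

text \<open>The conjugate-linear map \<open>\<tau> : \<B> \<otimes> \<A> \<rightarrow> \<A> \<otimes> \<B>\<close>, where \<open>ns\<close> encodes \<open>\<B>\<close> and \<open>ms\<close>
  encodes \<open>\<A>\<close>.\<close>

definition time_reversal :: "algebra \<Rightarrow> algebra \<Rightarrow> elem \<Rightarrow> elem" where
  "time_reversal ns ms =
     tensor_ext cnj ns ms (alg_tensor ms ns) (\<lambda>B A. mm_tensor (mm_dagger A) (mm_dagger B))"

text \<open>The Hilbert--Schmidt adjoint \<open>\<Phi>\<^sup>* : \<B> \<rightarrow> \<A>\<close> of \<open>\<Phi> : \<A> \<rightarrow> \<B>\<close>.\<close>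

definition hs_adjoint :: "algebra \<Rightarrow> algebra \<Rightarrow> (elem \<Rightarrow> elem) \<Rightarrow> elem \<Rightarrow> elem" where
  "hs_adjoint ms ns \<Phi> =
     (THE \<Psi>. \<Psi> \<in> linear_maps ns ms \<and>
        (\<forall>A\<in>elems ms. \<forall>B\<in>elems ns.
           mm_trace (mm_mult (mm_dagger (\<Phi> A)) B) = mm_trace (mm_mult (mm_dagger A) (\<Psi> B))))"

section \<open>Channels\<close>

definition completely_positive :: "algebra \<Rightarrow> algebra \<Rightarrow> (elem \<Rightarrow> elem) \<Rightarrow> bool" where
  "completely_positive ms ns \<Phi> \<longleftrightarrow>
     (\<forall>k>0. \<forall>A\<in>elems (alg_tensor [k] ms). mm_positive (alg_tensor [k] ms) A \<longrightarrow>
        mm_positive (alg_tensor [k] ns) (map_tensor [k] ms [k] ns (\<lambda>C. C) \<Phi> A))"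

definition trace_preserving :: "algebra \<Rightarrow> (elem \<Rightarrow> elem) \<Rightarrow> bool" where
  "trace_preserving ms \<Phi> \<longleftrightarrow> (\<forall>A\<in>elems ms. mm_trace (\<Phi> A) = mm_trace A)"

definition CPTP :: "algebra \<Rightarrow> algebra \<Rightarrow> (elem \<Rightarrow> elem) set" where
  "CPTP ms ns = {\<Phi> \<in> linear_maps ms ns. completely_positive ms ns \<Phi> \<and> trace_preserving ms \<Phi>}"

definition unital :: "algebra \<Rightarrow> algebra \<Rightarrow> (elem \<Rightarrow> elem) \<Rightarrow> bool" where
  "unital ms ns \<Phi> \<longleftrightarrow> \<Phi> (mm_one ms) = mm_one ns"

definition channel_state :: "algebra \<Rightarrow> algebra \<Rightarrow> (elem \<Rightarrow> elem) \<Rightarrow> elem" where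
  "channel_state ms ns \<Phi> =
     map_tensor ms ms ms ns (\<lambda>A. A) \<Phi>
       (hs_adjoint (alg_tensor ms ms) ms (mult_map ms) (mm_one ms))"

section \<open>States over time\<close>

type_synonym sot = "algebra \<Rightarrow> algebra \<Rightarrow> (elem \<Rightarrow> elem) \<Rightarrow> elem \<Rightarrow> elem"

definition state_over_time :: "sot \<Rightarrow> bool" where
  "state_over_time star \<longleftrightarrow>
     (\<forall>ms ns. multi_matrix ms \<longrightarrow> multi_matrix ns \<longrightarrow>
       (\<forall>\<Phi>\<in>CPTP ms ns. \<forall>\<rho>\<in>states ms.
          star ms ns \<Phi> \<rho> \<in> elems (alg_tensor ms ns) \<and>
          ptrace_snd ms ns (star ms ns \<Phi> \<rho>) = \<rho> \<and>
          ptrace_fst ms ns (star ms ns \<Phi> \<rho>) = \<Phi> \<rho>))"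

definition classical_limit :: "sot \<Rightarrow> bool" where
  "classical_limit star \<longleftrightarrow>
     (\<forall>ms ns. multi_matrix ms \<longrightarrow> multi_matrix ns \<longrightarrow>
       (\<forall>\<rho>\<in>states ms. \<forall>\<Phi>\<in>CPTP ms ns.
          mm_mult (channel_state ms ns \<Phi>) (mm_tensor \<rho> (mm_one ns)) =
          mm_mult (mm_tensor \<rho> (mm_one ns)) (channel_state ms ns \<Phi>) \<longrightarrow>
          star ms ns \<Phi> \<rho> = mm_mult (channel_state ms ns \<Phi>) (mm_tensor \<rho> (mm_one ns))))"

definition bayesian_inverse ::
  "sot \<Rightarrow> algebra \<Rightarrow> algebra \<Rightarrow> (elem \<Rightarrow> elem) \<Rightarrow> elem \<Rightarrow> (elem \<Rightarrow> elem) \<Rightarrow> bool" where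
  "bayesian_inverse star ms ns \<Phi> \<rho> \<Psi> \<longleftrightarrow>
     \<Psi> \<in> CPTP ns ms \<and>
     star ms ns \<Phi> \<rho> = time_reversal ns ms (star ns ms \<Psi> (\<Phi> \<rho>))"

end

theory Submission
  imports Defs
begin

text \<open>
  Since \<open>\<E>\<close> is unital and trace preserving, \<open>m = n\<close> and \<open>\<E>\<close> fixes \<open>\<rho>\<close>.  As \<open>\<rho> \<otimes> 1\<close> is a scalar, the
  classical limit axiom turns both states over time into \<open>1/m\<close> times channel states, so \<open>\<Psi>\<close> is a
  Bayesian inverse iff it is a channel with \<open>D[\<E>] = \<tau>(D[\<Psi>])\<close>.  Comparing entries on matrix units,
  the latter says exactly that \<open>\<Psi>\<close> is the Hilbert--Schmidt adjoint.  This adjoint preserves the trace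
  because \<open>\<E>\<close> is unital, and is completely positive because the cone of positive matrices is
  self-dual for the Hilbert--Schmidt inner product.
\<close>

text \<open>The classical limit axiom fixes \<open>star\<close> only where its commutation premise
  holds. A scalar \<open>\<rho> \<otimes> 1\<close> commutes with the channel state of every
  channel, and \<open>\<E> \<rho>\<close> is uniform again, so the axiom also evaluates
  \<open>star\<close> at an arbitrary candidate inverse. Existence and uniqueness therefore come out
  of one equivalence. The factor 1/m passes through the conjugate-linear time reversal because it is
  real. Two features of the definitions shape the work. Tensor products of maps, the multiplication
  map, time reversal and adjoints are definite descriptions, so each must be identified with an
  explicit matrix formula before entries can be compared. And positivity means having the form
  B^dagger B, whereas self-duality of the cone naturally yields a nonnegative quadratic form; a
  Cholesky factorization bridges the two.\<close>

section \<open>Positive semidefinite matrices are Gram matrices\<close>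

definition quad :: "nat \<Rightarrow> (nat \<Rightarrow> nat \<Rightarrow> complex) \<Rightarrow> (nat \<Rightarrow> complex) \<Rightarrow> complex" where
  "quad n X w = (\<Sum>i<n. \<Sum>j<n. cnj (w i) * X i j * w j)"

text \<open>On complex numbers \<open>0 \<le> z\<close> says that z is real and nonnegative, so this
  condition also encodes that X is Hermitian. Index functions replace matrices here so that Schur
  complements need no carrier conditions.\<close>

definition psd :: "nat \<Rightarrow> (nat \<Rightarrow> nat \<Rightarrow> complex) \<Rightarrow> bool" where
  "psd n X \<longleftrightarrow> (\<forall>w. 0 \<le> quad n X w)"

text \<open>Changing a single coordinate is all that is needed later: twice from zero it gives the
  two-coordinate tests, and with a suitable t it completes the square in coordinate r.\<close>

lemma quad_add_unit:
  assumes "r < n"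
  shows "quad n X (\<lambda>i. w i + (if i = r then t else 0)) =
    quad n X w + cnj t * (\<Sum>j<n. X r j * w j) + t * (\<Sum>i<n. cnj (w i) * X i r) + cnj t * t * X r r"
proof -
  define d where "d = (\<lambda>i. if i = r then t else 0)"
  have "quad n X (\<lambda>i. w i + d i) =
    quad n X w + (\<Sum>i<n. \<Sum>j<n. cnj (d i) * X i j * w j) + (\<Sum>i<n. \<Sum>j<n. cnj (w i) * X i j * d j)
     + (\<Sum>i<n. \<Sum>j<n. cnj (d i) * X i j * d j)"
    unfolding quad_def by (simp add: algebra_simps sum.distrib)
  moreover have "(\<Sum>j<n. cnj (w i) * X i j * d j) = t * (cnj (w i) * X i r)" for i
    using assms by (simp add: d_def if_distrib[of "(*) _"] mult_ac cong: if_cong)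
  moreover have "(\<Sum>i<n. \<Sum>j<n. cnj (d i) * X i j * w j) = cnj t * (\<Sum>j<n. X r j * w j)"
  proof -
    have "(\<Sum>j<n. cnj (d i) * X i j * w j) = (if i = r then cnj t * (\<Sum>j<n. X r j * w j) else 0)" for i
      by (simp add: d_def sum_distrib_left mult_ac)
    then show ?thesis using assms by simp
  qed
  moreover have "(\<Sum>i<n. \<Sum>j<n. cnj (d i) * X i j * d j) = cnj t * t * X r r"
  proof -
    have "(\<Sum>j<n. cnj (d i) * X i j * d j) = (if i = r then cnj t * t * X r r else 0)" for i
      using assms by (simp add: d_def if_distrib[of "(*) _"] mult_ac cong: if_cong)
    then show ?thesis using assms by simp
  qed
  ultimately show ?thesis by (simp add: d_def sum_distrib_left)
qed

lemma quad_two_units: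
  assumes "i < n" "j < n"
  shows "quad n X (\<lambda>k. (if k = i then a else 0) + (if k = j then b else 0)) =
    cnj a * a * X i i + cnj b * a * X j i + b * cnj a * X i j + cnj b * b * X j j"
proof -
  have 1: "quad n X (\<lambda>k. if k = i then a else 0) = cnj a * a * X i i"
    using quad_add_unit[OF assms(1), of X "\<lambda>_. 0" a] by (simp add: quad_def)
  have 2: "(\<Sum>k<n. X j k * (if k = i then a else 0)) = a * X j i"
    using assms by (simp add: if_distrib[of "(*) _"] mult_ac cong: if_cong)
  have 3: "(\<Sum>k<n. cnj (if k = i then a else 0) * X k j) = cnj a * X i j"
  proof -
    have "cnj (if k = i then a else 0) * X k j = (if k = i then cnj a * X i j else 0)" for k
      by simp
    then show ?thesis using assms by simp
  qed
  show ?thesis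
    unfolding quad_add_unit[OF assms(2)] 1 2 3 by (simp add: mult_ac)
qed

lemma psd_two_units:
  assumes "psd n X" "i < n" "j < n"
  shows "0 \<le> cnj a * a * X i i + cnj b * a * X j i + b * cnj a * X i j + cnj b * b * X j j"
  using assms(1) unfolding psd_def quad_two_units[OF assms(2,3), symmetric] by blast

lemma psd_diag: "psd n X \<Longrightarrow> i < n \<Longrightarrow> 0 \<le> X i i"
  using psd_two_units[of n X i i 1 0] by simp

text \<open>Polarization: the form is real at e_i + e_j and at e_i + \<i> e_j, which settles the
  imaginary and the real part of the two off-diagonal entries.\<close>

lemma psd_hermitian:
  assumes "psd n X" "i < n" "j < n"
  shows "X j i = cnj (X i j)"
proof -
  have "Im (X i i) = 0" "Im (X j j) = 0"
    using psd_diag[OF assms(1)] assms(2,3) by (auto simp: less_eq_complex_def)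
  moreover have "Im (X i i + X j i + X i j + X j j) = 0"
    using psd_two_units[OF assms, of 1 1] by (simp add: less_eq_complex_def)
  moreover have "Im (X i i - \<i> * X j i + \<i> * X i j + X j j) = 0"
    using psd_two_units[OF assms, of 1 \<i>] by (simp add: less_eq_complex_def)
  ultimately show ?thesis by (simp add: complex_eq_iff)
qed

lemma psd_zero_pivot:
  assumes "psd n X" "r < n" "j < n" "X r r = 0"
  shows "X r j = 0"
proof (rule ccontr)
  assume nz: "X r j \<noteq> 0"
  define p where "p = (cmod (X r j))\<^sup>2"
  have p: "p > 0" using nz by (simp add: p_def)
  \<comment> \<open>At the vector e_j - s X_rj e_r the form is X_jj - 2 s p, because the pivot
    vanishes. This s makes 2 s p exceed X_jj by exactly 1, so the value would be -1.\<close>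
  define s where "s = (Re (X j j) + 1) / (2 * p)"
  have h: "X j r = cnj (X r j)" using psd_hermitian assms by blast
  have pp: "X r j * cnj (X r j) = of_real p"
    using complex_norm_square[of "X r j"] by (simp add: p_def)
  have "0 \<le> cnj 1 * 1 * X j j + cnj (- of_real s * X r j) * 1 * X r j
     + (- of_real s * X r j) * cnj 1 * X j r + cnj (- of_real s * X r j) * (- of_real s * X r j) * X r r"
    by (rule psd_two_units[OF assms(1,3,2)])
  also have "\<dots> = X j j - of_real (2 * s) * (X r j * cnj (X r j))"
    using assms(4) h by (simp add: algebra_simps)
  also have "\<dots> = X j j - of_real (2 * s * p)" by (simp add: pp)
  finally have "2 * s * p \<le> Re (X j j)" by (simp add: less_eq_complex_def)
  moreover have "2 * s * p = Re (X j j) + 1" using p by (simp add: s_def)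
  ultimately show False by simp
qed

text \<open>The form of the complement at w is the form of X at w with coordinate r shifted by -v /
  X_rr. The shift completes the square in that coordinate.\<close>

lemma psd_schur_complement:
  assumes "psd n X" "r < n" "X r r \<noteq> 0"
  shows "psd n (\<lambda>i j. X i j - X i r * X r j / X r r)"
  unfolding psd_def
proof
  fix w
  define v where "v = (\<Sum>j<n. X r j * w j)"
  define u where "u = (\<Sum>i<n. cnj (w i) * X i r)"
  have "Im (X r r) = 0" using psd_diag[OF assms(1,2)] by (simp add: less_eq_complex_def)
  then have real: "cnj (X r r) = X r r" by (simp add: complex_eq_iff)
  have vu: "cnj v = u"
  proof -
    have "cnj (X r i * w i) = cnj (w i) * X i r" if "i < n" for i
      using psd_hermitian[OF assms(1,2) that] by (simp add: mult_ac)
    then show ?thesis unfolding v_def u_def cnj_sum by (intro sum.cong) auto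
  qed
  have "quad n (\<lambda>i j. X i j - X i r * X r j / X r r) w = quad n X w - u * v / X r r"
    unfolding quad_def u_def v_def sum_product sum_divide_distrib sum_subtractf[symmetric]
    by (simp add: algebra_simps)
  also have "\<dots> = quad n X (\<lambda>i. w i + (if i = r then - v / X r r else 0))"
    using assms(3) by (simp add: quad_add_unit[OF assms(2)] vu real flip: u_def v_def)
  also have "0 \<le> \<dots>" using assms(1) psd_def by blast
  finally show "0 \<le> quad n (\<lambda>i j. X i j - X i r * X r j / X r r) w" .
qed

text \<open>Cholesky factorization: the last nonzero row and column are cleared by a Schur complement.\<close>

lemma psd_imp_gram_support:
  assumes "psd n X" "r \<le> n"
    and "\<And>i j. i < n \<Longrightarrow> j < n \<Longrightarrow> r \<le> i \<or> r \<le> j \<Longrightarrow> X i j = 0"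
  shows "\<exists>c. \<forall>i<n. \<forall>j<n. X i j = (\<Sum>k<r. cnj (c k i) * c k j)"
  using assms
proof (induction r arbitrary: X)
  case 0
  then show ?case by simp
next
  case (Suc r)
  have r: "r < n" using Suc.prems(2) by simp
  note herm = psd_hermitian[OF Suc.prems(1)]
  show ?case
  proof (cases "X r r = 0")
    case True
    have row: "X r j = 0" if "j < n" for j
      using psd_zero_pivot[OF Suc.prems(1) r that True] .
    have col: "X j r = 0" if "j < n" for j
      using herm[OF r that] row[OF that] by simp
    obtain c where c: "\<forall>i<n. \<forall>j<n. X i j = (\<Sum>k<r. cnj (c k i) * c k j)"
    proof -
      have "X i j = 0" if "i < n" "j < n" "r \<le> i \<or> r \<le> j" for i j
        using that row col Suc.prems(3)[of i j] by (metis le_antisym not_less_eq_eq)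
      then show ?thesis using Suc.IH[OF Suc.prems(1)] r that by auto
    qed
    \<comment> \<open>The zero pivot contributes nothing, so a zero vector fills the additional
      place.\<close>
    define c' where "c' = (\<lambda>k i. if k = r then 0 else c k i)"
    have "(\<Sum>k<Suc r. cnj (c' k i) * c' k j) = (\<Sum>k<r. cnj (c k i) * c k j)" for i j
      by (simp add: c'_def)
    then show ?thesis using c by (intro exI[of _ c']) auto
  next
    case False
    define X' where "X' = (\<lambda>i j. X i j - X i r * X r j / X r r)"
    have psd': "psd n X'"
      unfolding X'_def by (rule psd_schur_complement[OF Suc.prems(1) r False])
    \<comment> \<open>Row and column r are cleared by the complement. Beyond r the entry of X is
      zero, and so is one factor of the subtracted product.\<close>
    have "X' i j = 0" if "i < n" "j < n" "r \<le> i \<or> r \<le> j" for i j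
    proof (cases "i = r \<or> j = r")
      case True
      then show ?thesis using False by (auto simp: X'_def)
    next
      case False
      then have "Suc r \<le> i \<or> Suc r \<le> j" using that by auto
      then have "X i j = 0" "X i r = 0 \<or> X r j = 0"
        using Suc.prems(3) that r by auto
      then show ?thesis by (auto simp: X'_def)
    qed
    then obtain c where c: "\<forall>i<n. \<forall>j<n. X' i j = (\<Sum>k<r. cnj (c k i) * c k j)"
      using Suc.IH[OF psd'] r by auto
    define p where "p = Re (X r r)"
    have p: "X r r = of_real p" "0 \<le> p"
      using psd_diag[OF Suc.prems(1) r] by (auto simp: p_def less_eq_complex_def complex_eq_iff)
    \<comment> \<open>The new Gram vector is the pivot row divided by the square root of the pivot;
      its rank-one term restores exactly what the Schur complement removed.\<close>
    define c' where "c' = (\<lambda>k i. if k = r then X r i / of_real (sqrt p) else c k i)"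
    have "X i j = (\<Sum>k<Suc r. cnj (c' k i) * c' k j)" if "i < n" "j < n" for i j
    proof -
      have "(\<Sum>k<Suc r. cnj (c' k i) * c' k j) = X' i j + cnj (c' r i) * c' r j"
        using c that by (simp add: c'_def)
      also have "cnj (c' r i) * c' r j = X i r * X r j / X r r"
        using herm[OF r that(1)] p by (simp add: c'_def flip: of_real_mult)
      finally show ?thesis by (simp add: X'_def)
    qed
    then show ?thesis by blast
  qed
qed

lemma psd_imp_gram:
  assumes "psd n X"
  obtains c where "\<And>i j. i < n \<Longrightarrow> j < n \<Longrightarrow> X i j = (\<Sum>k<n. cnj (c k i) * c k j)"
  using psd_imp_gram_support[OF assms, of n] by auto

lemma gram_psd: "psd n (\<lambda>i j. \<Sum>k<(d::nat). cnj (c k i) * c k j)"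
  unfolding psd_def
proof
  fix w
  define v where "v = (\<lambda>k. \<Sum>i<n. c k i * w i)"
  have "quad n (\<lambda>i j. \<Sum>k<d. cnj (c k i) * c k j) w = (\<Sum>i<n. \<Sum>j<n. \<Sum>k<d. cnj (c k i * w i) * (c k j * w j))"
    unfolding quad_def by (simp add: sum_distrib_left sum_distrib_right mult_ac)
  also have "\<dots> = (\<Sum>k<d. \<Sum>i<n. \<Sum>j<n. cnj (c k i * w i) * (c k j * w j))"
    by (subst (2) sum.swap, subst sum.swap) (rule refl)
  also have "\<dots> = (\<Sum>k<d. cnj (v k) * v k)"
    by (simp add: v_def sum_product)
  also have "0 \<le> \<dots>"
    by (rule sum_nonneg) (simp add: less_eq_complex_def)
  finally show "0 \<le> quad n (\<lambda>i j. \<Sum>k<d. cnj (c k i) * c k j) w" .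
qed

section \<open>Full matrix algebras\<close>

lemma mem_elems_single: "X \<in> elems [m] \<longleftrightarrow> (\<exists>A\<in>carrier_mat m m. X = [A])"
  by (auto simp: elems_def list_all2_Cons2)

lemma single_mem_elems [simp]: "[A] \<in> elems [m] \<longleftrightarrow> A \<in> carrier_mat m m"
  by (auto simp: mem_elems_single)

lemma ball_elems_single: "(\<forall>X\<in>elems [m]. P X) \<longleftrightarrow> (\<forall>A\<in>carrier_mat m m. P [A])"
  and bex_elems_single: "(\<exists>X\<in>elems [m]. P X) \<longleftrightarrow> (\<exists>A\<in>carrier_mat m m. P [A])"
  by (auto simp: mem_elems_single)

lemma alg_tensor_single [simp]: "alg_tensor [m] [n] = [m * n]"
  by (simp add: alg_tensor_def)

lemma mm_tensor_single [simp]: "mm_tensor [A] [B] = [kronecker A B]"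
  by (simp add: mm_tensor_def)

lemma mm_add_single [simp]: "mm_add [A] [B] = [A + B]"
  by (simp add: mm_add_def)

lemma mm_scale_single [simp]: "mm_scale c [A] = [c \<cdot>\<^sub>m A]"
  by (simp add: mm_scale_def)

lemma mm_mult_single [simp]: "mm_mult [A] [B] = [A * B]"
  by (simp add: mm_mult_def)

lemma mm_dagger_single [simp]: "mm_dagger [A] = [mat_adjoint A]"
  by (simp add: mm_dagger_def)

lemma mm_trace_single [simp]: "mm_trace [A] = mat_trace A"
  by (simp add: mm_trace_def)

lemma mm_one_single [simp]: "mm_one [m] = [1\<^sub>m m]"
  by (simp add: mm_one_def)

lemma mat_adjoint_carrier [simp]: "A \<in> carrier_mat m n \<Longrightarrow> mat_adjoint A \<in> carrier_mat n m"
  by (auto simp: mat_adjoint_def mat_of_rows_def)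

lemma dim_mat_adjoint [simp]:
  "dim_row (mat_adjoint A) = dim_col A" "dim_col (mat_adjoint A) = dim_row A"
  by (simp_all add: mat_adjoint_def mat_of_rows_def)

lemma index_mat_adjoint [simp]:
  fixes A :: "complex mat"
  shows "i < dim_col A \<Longrightarrow> j < dim_row A \<Longrightarrow> mat_adjoint A $$ (i, j) = cnj (A $$ (j, i))"
  by (simp add: mat_adjoint_def mat_of_rows_def)

section \<open>Matrix units and semilinear maps of matrices\<close>

definition mat_unit :: "nat \<Rightarrow> nat \<Rightarrow> nat \<Rightarrow> complex mat" where
  "mat_unit m i j = mat m m (\<lambda>p. if p = (i, j) then 1 else 0)"

lemma mat_unit_carrier [simp]: "mat_unit m i j \<in> carrier_mat m m"
  by (simp add: mat_unit_def)

lemma index_mat_unit [simp]: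
  "a < m \<Longrightarrow> b < m \<Longrightarrow> mat_unit m i j $$ (a, b) = (if a = i \<and> b = j then 1 else 0)"
  by (simp add: mat_unit_def)

text \<open>A scalar functional with an arbitrary twist serves three uses at once: entries of linear
  maps, entries of conjugate-linear maps, and the Hilbert--Schmidt product in its conjugate-linear
  argument. The induction runs over the set of positions at which A has been kept.\<close>

lemma functional_mat_unit_expansion:
  fixes g :: "complex mat \<Rightarrow> complex"
  assumes add: "\<And>A B. A \<in> carrier_mat m m \<Longrightarrow> B \<in> carrier_mat m m \<Longrightarrow> g (A + B) = g A + g B"
    and smult: "\<And>c A. A \<in> carrier_mat m m \<Longrightarrow> g (c \<cdot>\<^sub>m A) = \<sigma> c * g A"
    and A: "A \<in> carrier_mat m m"
  shows "g A = (\<Sum>i<m. \<Sum>j<m. \<sigma> (A $$ (i, j)) * g (mat_unit m i j))"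
proof -
  define R where "R S = mat m m (\<lambda>p. if p \<in> S then A $$ p else 0)" for S
  have R: "R S \<in> carrier_mat m m" for S by (simp add: R_def)
  have "g (R S) = (\<Sum>(i, j)\<in>S. \<sigma> (A $$ (i, j)) * g (mat_unit m i j))"
    if "finite S" "S \<subseteq> {..<m} \<times> {..<m}" for S
    using that
  proof (induction S rule: finite_induct)
    case empty
    \<comment> \<open>Additivity alone gives g 0 = 0, so nothing has to be known about the twist at
      0.\<close>
    have "R {} + R {} = R {}" by (auto simp: R_def)
    then have "g (R {}) = 0" using add[OF R R, of "{}" "{}"] by simp
    then show ?case by simp
  next
    case (insert p S)
    obtain i j where p: "p = (i, j)" by force
    have "R (insert p S) = A $$ (i, j) \<cdot>\<^sub>m mat_unit m i j + R S"
      using insert.hyps(2) p by (intro eq_matI) (auto simp: R_def mat_unit_def)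
    then have "g (R (insert p S)) = \<sigma> (A $$ (i, j)) * g (mat_unit m i j) + g (R S)"
      using add[OF _ R] smult by simp
    then show ?case using insert p by simp
  qed
  from this[of "{..<m} \<times> {..<m}"] have
    "g (R ({..<m} \<times> {..<m})) = (\<Sum>(i, j)\<in>{..<m} \<times> {..<m}. \<sigma> (A $$ (i, j)) * g (mat_unit m i j))"
    by simp
  moreover have "R ({..<m} \<times> {..<m}) = A"
    using A by (intro eq_matI) (auto simp: R_def)
  ultimately show ?thesis by (simp add: sum.cartesian_product)
qed

definition mat_semilinear ::
  "(complex \<Rightarrow> complex) \<Rightarrow> nat \<Rightarrow> nat \<Rightarrow> (complex mat \<Rightarrow> complex mat) \<Rightarrow> bool" where
  "mat_semilinear \<sigma> m n G \<longleftrightarrow>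
     (\<forall>A\<in>carrier_mat m m. G A \<in> carrier_mat n n) \<and>
     (\<forall>A\<in>carrier_mat m m. \<forall>B\<in>carrier_mat m m. G (A + B) = G A + G B) \<and>
     (\<forall>c. \<forall>A\<in>carrier_mat m m. G (c \<cdot>\<^sub>m A) = \<sigma> c \<cdot>\<^sub>m G A)"

abbreviation mat_linear :: "nat \<Rightarrow> nat \<Rightarrow> (complex mat \<Rightarrow> complex mat) \<Rightarrow> bool" where
  "mat_linear \<equiv> mat_semilinear (\<lambda>c. c)"

lemma mat_semilinear_carrier:
  "mat_semilinear \<sigma> m n G \<Longrightarrow> A \<in> carrier_mat m m \<Longrightarrow> G A \<in> carrier_mat n n"
  by (simp add: mat_semilinear_def)

lemma mat_semilinear_add:
  "mat_semilinear \<sigma> m n G \<Longrightarrow> A \<in> carrier_mat m m \<Longrightarrow> B \<in> carrier_mat m m \<Longrightarrow> G (A + B) = G A + G B"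
  by (simp add: mat_semilinear_def)

lemma mat_semilinear_smult:
  "mat_semilinear \<sigma> m n G \<Longrightarrow> A \<in> carrier_mat m m \<Longrightarrow> G (c \<cdot>\<^sub>m A) = \<sigma> c \<cdot>\<^sub>m G A"
  by (simp add: mat_semilinear_def)

lemma mat_semilinear_eqI:
  assumes G: "mat_semilinear \<sigma> m n G" and H: "mat_semilinear \<sigma> m n H"
    and eq: "\<And>i j. i < m \<Longrightarrow> j < m \<Longrightarrow> G (mat_unit m i j) = H (mat_unit m i j)"
    and A: "A \<in> carrier_mat m m"
  shows "G A = H A"
proof -
  have expand: "F A $$ (a, b) = (\<Sum>i<m. \<Sum>j<m. \<sigma> (A $$ (i, j)) * F (mat_unit m i j) $$ (a, b))"
    if F: "mat_semilinear \<sigma> m n F" and ab: "a < n" "b < n" for F a b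
  proof (rule functional_mat_unit_expansion[OF _ _ A])
    fix A B :: "complex mat" and c
    assume A: "A \<in> carrier_mat m m"
    have d: "F A \<in> carrier_mat n n" using mat_semilinear_carrier[OF F A] .
    show "F (c \<cdot>\<^sub>m A) $$ (a, b) = \<sigma> c * F A $$ (a, b)"
      using d ab by (simp add: mat_semilinear_smult[OF F A])
    assume B: "B \<in> carrier_mat m m"
    have "F B \<in> carrier_mat n n" using mat_semilinear_carrier[OF F B] .
    then show "F (A + B) $$ (a, b) = F A $$ (a, b) + F B $$ (a, b)"
      using d ab by (simp add: mat_semilinear_add[OF F A B])
  qed
  have "G A \<in> carrier_mat n n" "H A \<in> carrier_mat n n"
    using mat_semilinear_carrier[OF G A] mat_semilinear_carrier[OF H A] .
  then show ?thesis
    by (intro eq_matI) (auto simp: expand[OF G] expand[OF H] eq)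
qed

text \<open>Restricting to \<open>elems [m]\<close> makes the map extensional, so that two lifts are
  equal as soon as they agree on m by m matrices. This is what lets uniqueness in the definite
  descriptions be proved on matrices.\<close>

definition lift :: "nat \<Rightarrow> (complex mat \<Rightarrow> complex mat) \<Rightarrow> elem \<Rightarrow> elem" where
  "lift m G = (\<lambda>X\<in>elems [m]. [G (hd X)])"

lemma lift_single [simp]: "A \<in> carrier_mat m m \<Longrightarrow> lift m G [A] = [G A]"
  by (simp add: lift_def)

lemma lift_eq_iff: "lift m G = lift m H \<longleftrightarrow> (\<forall>A\<in>carrier_mat m m. G A = H A)"
proof
  assume "lift m G = lift m H"
  then have "lift m G [A] = lift m H [A]" for A by simp
  then show "\<forall>A\<in>carrier_mat m m. G A = H A" by auto (metis lift_single list.inject)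
next
  assume "\<forall>A\<in>carrier_mat m m. G A = H A"
  then show "lift m G = lift m H"
    by (auto simp: lift_def mem_elems_single fun_eq_iff restrict_def)
qed

lemma lift_mem_semilinear_maps:
  assumes "mat_semilinear \<sigma> m n G"
  shows "lift m G \<in> semilinear_maps \<sigma> [m] [n]"
proof -
  have "lift m G \<in> elems [m] \<rightarrow>\<^sub>E elems [n]"
    using assms by (auto simp: mem_elems_single lift_def mat_semilinear_carrier)
  then show ?thesis
    using assms unfolding semilinear_maps_def mat_semilinear_def by (auto simp: mem_elems_single)
qed

text \<open>Every map in play, including unknown ones such as candidate inverses, can thus be
  replaced by a map of plain matrices.\<close>

lemma semilinear_mapsE:
  assumes T: "T \<in> semilinear_maps \<sigma> [m] [n]"
  obtains G where "T = lift m G" "mat_semilinear \<sigma> m n G"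
proof -
  define G where "G A = hd (T [A])" for A
  have TG: "T [A] = [G A]" "G A \<in> carrier_mat n n" if "A \<in> carrier_mat m m" for A
  proof -
    have "T [A] \<in> elems [n]" using T that by (auto simp: semilinear_maps_def)
    then show "T [A] = [G A]" "G A \<in> carrier_mat n n" by (auto simp: mem_elems_single G_def)
  qed
  have "T \<in> extensional (elems [m])" using T by (auto simp: semilinear_maps_def PiE_def)
  then have "T = lift m G"
    by (intro extensionalityI[of T "elems [m]"]) (auto simp: mem_elems_single TG lift_def)
  moreover have "mat_semilinear \<sigma> m n G"
    unfolding mat_semilinear_def
  proof (intro conjI ballI allI)
    fix A B :: "complex mat" and c
    assume A: "A \<in> carrier_mat m m"
    show "G A \<in> carrier_mat n n" by (rule TG(2)[OF A])
    have "T (mm_scale c [A]) = mm_scale (\<sigma> c) (T [A])"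
      using T A unfolding semilinear_maps_def by (auto simp del: mm_scale_single)
    then show "G (c \<cdot>\<^sub>m A) = \<sigma> c \<cdot>\<^sub>m G A" using A by (simp add: TG)
    assume B: "B \<in> carrier_mat m m"
    have "T (mm_add [A] [B]) = mm_add (T [A]) (T [B])"
      using T A B unfolding semilinear_maps_def by (auto simp del: mm_add_single)
    then show "G (A + B) = G A + G B" using A B by (simp add: TG)
  qed
  ultimately show ?thesis using that by blast
qed

section \<open>Tensor products of full matrix algebras\<close>

lemma pair_index_less: "i < m \<Longrightarrow> k < n \<Longrightarrow> i * n + k < m * (n::nat)"
proof -
  assume "i < m" "k < n"
  then have "i * n + k < Suc i * n" by simp
  also have "\<dots> \<le> m * n" using \<open>i < m\<close> by (intro mult_le_mono1) simp
  finally show ?thesis .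
qed

lemma pair_index_div [simp]: "k < n \<Longrightarrow> (i * n + k) div n = (i::nat)"
  by simp

lemma pair_index_mod [simp]: "k < n \<Longrightarrow> (i * n + k) mod n = (k::nat)"
  by simp

lemma pair_index_eq_iff:
  "k < n \<Longrightarrow> l < n \<Longrightarrow> i * n + k = j * n + l \<longleftrightarrow> i = j \<and> k = (l::nat)"
  by (metis pair_index_div pair_index_mod)

lemma pair_index_bounds:
  assumes "s < m * (n::nat)"
  shows "s div n < m" "s mod n < n"
proof -
  have "0 < n" using assms by (cases n) auto
  then show "s div n < m" "s mod n < n" using assms by (auto simp: less_mult_imp_div_less)
qed

lemma sum_pair_index:
  fixes f :: "nat \<Rightarrow> 'a::comm_monoid_add"
  shows "(\<Sum>s<m * n. f s) = (\<Sum>i<m. \<Sum>k<n. f (i * n + k))"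
proof -
  have "sum f {i * n..<i * n + n} = (\<Sum>k<n. f (i * n + k))" for i
    by (rule sum.reindex_bij_witness[of _ "\<lambda>k. i * n + k" "\<lambda>s. s - i * n"]) auto
  then show ?thesis by (simp flip: sum.nat_group)
qed

lemma kronecker_carrier [simp]:
  "A \<in> carrier_mat m m \<Longrightarrow> B \<in> carrier_mat n n \<Longrightarrow> kronecker A B \<in> carrier_mat (m * n) (m * n)"
  by (simp add: kronecker_def)

lemma index_kronecker:
  "A \<in> carrier_mat m m \<Longrightarrow> B \<in> carrier_mat n n \<Longrightarrow> s < m * n \<Longrightarrow> t < m * n \<Longrightarrow>
    kronecker A B $$ (s, t) = A $$ (s div n, t div n) * B $$ (s mod n, t mod n)"
  by (simp add: kronecker_def)

text \<open>Matrix units of the product algebra are elementary tensors, so a semilinear map on it is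
  determined by its values on elementary tensors.\<close>

lemma mat_unit_eq_kronecker:
  assumes "s < m * n" "t < m * n"
  shows "mat_unit (m * n) s t =
    kronecker (mat_unit m (s div n) (t div n)) (mat_unit n (s mod n) (t mod n))"
proof (rule eq_matI)
  show "dim_row (mat_unit (m * n) s t) =
    dim_row (kronecker (mat_unit m (s div n) (t div n)) (mat_unit n (s mod n) (t mod n)))"
   "dim_col (mat_unit (m * n) s t) =
    dim_col (kronecker (mat_unit m (s div n) (t div n)) (mat_unit n (s mod n) (t mod n)))"
   by (simp_all add: kronecker_def mat_unit_def)
  fix a b assume "a < dim_row (kronecker (mat_unit m (s div n) (t div n)) (mat_unit n (s mod n) (t mod n)))"
    "b < dim_col (kronecker (mat_unit m (s div n) (t div n)) (mat_unit n (s mod n) (t mod n)))"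
  then have ab: "a < m * n" "b < m * n" by (simp_all add: kronecker_def mat_unit_def)
  have idx: "x = y \<longleftrightarrow> x div n = y div n \<and> x mod n = y mod n" for x y :: nat
    by (metis div_mult_mod_eq)
  have "kronecker (mat_unit m (s div n) (t div n)) (mat_unit n (s mod n) (t mod n)) $$ (a, b) =
    mat_unit m (s div n) (t div n) $$ (a div n, b div n) * mat_unit n (s mod n) (t mod n) $$ (a mod n, b mod n)"
    by (rule index_kronecker) (use ab in simp_all)
  also have "\<dots> = (if a div n = s div n \<and> b div n = t div n then 1 else 0) *
      (if a mod n = s mod n \<and> b mod n = t mod n then 1 else 0)"
    by (simp only: index_mat_unit pair_index_bounds[OF ab(1)] pair_index_bounds[OF ab(2)])
  also have "\<dots> = (if a = s \<and> b = t then 1 else 0)"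
    using idx[of a s] idx[of b t] by (simp split: if_split)
  also have "\<dots> = mat_unit (m * n) s t $$ (a, b)"
    by (simp only: index_mat_unit ab)
  finally show "mat_unit (m * n) s t $$ (a, b) =
    kronecker (mat_unit m (s div n) (t div n)) (mat_unit n (s mod n) (t mod n)) $$ (a, b)" ..
qed

text \<open>This evaluates the definite description: an explicit semilinear map with the right
  values on elementary tensors is the only one. It provides the closed forms of
  \<open>map_tensor\<close>, \<open>mult_map\<close> and \<open>time_reversal\<close>.\<close>

lemma tensor_ext_eqI:
  assumes T: "mat_semilinear \<sigma> (m * n) k T"
    and eq: "\<And>A B. A \<in> carrier_mat m m \<Longrightarrow> B \<in> carrier_mat n n \<Longrightarrow> [T (kronecker A B)] = f [A] [B]"
  shows "tensor_ext \<sigma> [m] [n] [k] f = lift (m * n) T"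
  unfolding tensor_ext_def
proof (rule the_equality)
  have "lift (m * n) T (mm_tensor X Y) = f X Y" if "X\<in>elems [m]" "Y\<in>elems [n]" for X Y
    using that eq by (auto simp: mem_elems_single)
  then show "lift (m * n) T \<in> semilinear_maps \<sigma> (alg_tensor [m] [n]) [k] \<and>
    (\<forall>A\<in>elems [m]. \<forall>B\<in>elems [n]. lift (m * n) T (mm_tensor A B) = f A B)"
    using lift_mem_semilinear_maps[OF T] by simp
next
  fix S
  assume S: "S \<in> semilinear_maps \<sigma> (alg_tensor [m] [n]) [k] \<and>
    (\<forall>A\<in>elems [m]. \<forall>B\<in>elems [n]. S (mm_tensor A B) = f A B)"
  then obtain G where G: "S = lift (m * n) G" "mat_semilinear \<sigma> (m * n) k G"
    using semilinear_mapsE[of S \<sigma> "m * n" k] by auto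
  have GT: "G (kronecker A B) = T (kronecker A B)" if A: "A \<in> carrier_mat m m" and B: "B \<in> carrier_mat n n" for A B
  proof -
    have "S (mm_tensor [A] [B]) = f [A] [B]"
      using S A B by (simp del: mm_tensor_single)
    then show ?thesis using A B eq[OF A B, symmetric] by (simp add: G(1))
  qed
  have "G (mat_unit (m * n) i j) = T (mat_unit (m * n) i j)" if "i < m * n" "j < m * n" for i j
    unfolding mat_unit_eq_kronecker[OF that] by (rule GT) simp_all
  then show "S = lift (m * n) T"
    unfolding G(1) lift_eq_iff using mat_semilinear_eqI[OF G(2) T] by blast
qed

section \<open>Block matrices and ampliations\<close>

definition block :: "nat \<Rightarrow> complex mat \<Rightarrow> nat \<Rightarrow> nat \<Rightarrow> complex mat" where
  "block n X i j = mat n n (\<lambda>(k, l). X $$ (i * n + k, j * n + l))"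

lemma block_carrier [simp]: "block n X i j \<in> carrier_mat n n"
  by (simp add: block_def)

lemma index_block [simp]:
  "k < n \<Longrightarrow> l < n \<Longrightarrow> block n X i j $$ (k, l) = X $$ (i * n + k, j * n + l)"
  by (simp add: block_def)

lemma block_add:
  assumes "X \<in> carrier_mat (m * n) (m * n)" "Y \<in> carrier_mat (m * n) (m * n)" "i < m" "j < m"
  shows "block n (X + Y) i j = block n X i j + block n Y i j"
  using assms by (intro eq_matI) (auto simp: block_def pair_index_less)

lemma block_smult:
  assumes "X \<in> carrier_mat (m * n) (m * n)" "i < m" "j < m"
  shows "block n (c \<cdot>\<^sub>m X) i j = c \<cdot>\<^sub>m block n X i j"
  using assms by (intro eq_matI) (auto simp: block_def pair_index_less)

lemma block_kronecker:
  assumes "A \<in> carrier_mat m m" "B \<in> carrier_mat n n" "i < m" "j < m"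
  shows "block n (kronecker A B) i j = A $$ (i, j) \<cdot>\<^sub>m B"
  using assms by (intro eq_matI) (auto simp: block_def pair_index_less index_kronecker[where m=m and n=n])

text \<open>The tensor product of the identity of M_k with G, seen on k by k matrices with entries
  in M_m: G is applied to each block.\<close>

definition ampliation :: "nat \<Rightarrow> nat \<Rightarrow> nat \<Rightarrow> (complex mat \<Rightarrow> complex mat) \<Rightarrow> complex mat \<Rightarrow> complex mat" where
  "ampliation k m n G X =
     mat (k * n) (k * n) (\<lambda>(s, t). G (block m X (s div n) (t div n)) $$ (s mod n, t mod n))"

lemma ampliation_carrier [simp]: "ampliation k m n G X \<in> carrier_mat (k * n) (k * n)"
  by (simp add: ampliation_def)

lemma block_ampliation:
  assumes G: "mat_linear m n G" and "i < k" "j < k"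
  shows "block n (ampliation k m n G X) i j = G (block m X i j)"
  using mat_semilinear_carrier[OF G block_carrier, of X i j] assms(2,3)
  by (intro eq_matI) (auto simp: block_def[of n] ampliation_def pair_index_less)

lemma block_eqI:
  assumes X: "X \<in> carrier_mat (m * n) (m * n)" and Y: "Y \<in> carrier_mat (m * n) (m * n)"
    and eq: "\<And>i j. i < m \<Longrightarrow> j < m \<Longrightarrow> block n X i j = block n Y i j"
  shows "X = Y"
proof (rule eq_matI)
  fix s t
  assume "s < dim_row Y" "t < dim_col Y"
  then have "s < m * n" "t < m * n" using Y by auto
  note b = pair_index_bounds[OF this(1)] pair_index_bounds[OF this(2)]
  have "Z $$ (s, t) = block n Z (s div n) (t div n) $$ (s mod n, t mod n)" for Z
    by (simp only: index_block[OF b(2,4)] div_mult_mod_eq)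
  then show "X $$ (s, t) = Y $$ (s, t)"
    using eq[OF b(1,3)] by metis
qed (use X Y in auto)

lemma ampliation_linear:
  assumes G: "mat_linear m n G"
  shows "mat_linear (k * m) (k * n) (ampliation k m n G)"
  unfolding mat_semilinear_def
proof (intro conjI ballI allI)
  fix X Y :: "complex mat" and c
  assume X: "X \<in> carrier_mat (k * m) (k * m)"
  show "ampliation k m n G (c \<cdot>\<^sub>m X) = c \<cdot>\<^sub>m ampliation k m n G X"
    by (rule block_eqI[of _ k n])
      (simp_all add: block_ampliation[OF G] block_smult[of _ k] X mat_semilinear_smult[OF G])
  assume Y: "Y \<in> carrier_mat (k * m) (k * m)"
  show "ampliation k m n G (X + Y) = ampliation k m n G X + ampliation k m n G Y"
    by (rule block_eqI[of _ k n])
      (simp_all add: block_ampliation[OF G] block_add[of _ k] X Y mat_semilinear_add[OF G])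
qed simp

lemma map_tensor_id_lift:
  assumes G: "mat_linear m n G"
  shows "map_tensor [k] [m] [k] [n] (\<lambda>C. C) (lift m G) = lift (k * m) (ampliation k m n G)"
  unfolding map_tensor_def alg_tensor_single
proof (rule tensor_ext_eqI[OF ampliation_linear[OF G]])
  fix A B :: "complex mat"
  assume A: "A \<in> carrier_mat k k" and B: "B \<in> carrier_mat m m"
  have GB: "G B \<in> carrier_mat n n" using mat_semilinear_carrier[OF G B] .
  have "ampliation k m n G (kronecker A B) = kronecker A (G B)"
    by (rule block_eqI[of _ k n])
      (simp_all add: block_ampliation[OF G] block_kronecker[of _ k] A B GB mat_semilinear_smult[OF G])
  then show "[ampliation k m n G (kronecker A B)] = mm_tensor [A] (lift m G [B])"
    using B by simp
qed

section \<open>Hilbert--Schmidt adjoints\<close>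

definition hs_inner :: "complex mat \<Rightarrow> complex mat \<Rightarrow> complex" where
  "hs_inner A B = (\<Sum>i<dim_row A. \<Sum>j<dim_col A. cnj (A $$ (i, j)) * B $$ (i, j))"

lemma hs_inner_carrier:
  "A \<in> carrier_mat m m \<Longrightarrow> hs_inner A B = (\<Sum>i<m. \<Sum>j<m. cnj (A $$ (i, j)) * B $$ (i, j))"
  by (simp add: hs_inner_def)

lemma trace_adjoint_mult:
  assumes A: "A \<in> carrier_mat m m" and B: "B \<in> carrier_mat m m"
  shows "mat_trace (mat_adjoint A * B) = hs_inner A B"
proof -
  have "(mat_adjoint A * B) $$ (i, i) = (\<Sum>k<m. cnj (A $$ (k, i)) * B $$ (k, i))" if "i < m" for i
    using A B that
    by (simp add: scalar_prod_def atLeast0LessThan)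
  then have "mat_trace (mat_adjoint A * B) = (\<Sum>i<m. \<Sum>k<m. cnj (A $$ (k, i)) * B $$ (k, i))"
    using A by (simp add: mat_trace_def)
  also have "\<dots> = hs_inner A B" unfolding hs_inner_carrier[OF A] by (rule sum.swap)
  finally show ?thesis .
qed

lemma hs_inner_mat_unit:
  assumes "i < m" "j < m"
  shows "hs_inner (mat_unit m i j) B = B $$ (i, j)"
proof -
  have "(\<Sum>b<m. cnj (mat_unit m i j $$ (a, b)) * B $$ (a, b)) = (if a = i then B $$ (i, j) else 0)"
    if "a < m" for a
  proof -
    have "(\<Sum>b<m. cnj (mat_unit m i j $$ (a, b)) * B $$ (a, b)) =
      (\<Sum>b<m. if b = j then (if a = i then B $$ (i, j) else 0) else 0)"
      using that by (intro sum.cong) auto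
    then show ?thesis using assms by simp
  qed
  then show ?thesis using assms by (simp add: hs_inner_carrier[OF mat_unit_carrier])
qed

lemma hs_inner_mat_unit_right:
  assumes "i < m" "j < m" "A \<in> carrier_mat m m"
  shows "hs_inner A (mat_unit m i j) = cnj (A $$ (i, j))"
proof -
  have "hs_inner A (mat_unit m i j) = cnj (hs_inner (mat_unit m i j) A)"
    by (simp add: hs_inner_carrier[OF assms(3)] hs_inner_carrier[OF mat_unit_carrier] mult.commute)
  then show ?thesis using hs_inner_mat_unit[OF assms(1,2)] by simp
qed

lemma hs_inner_add_right:
  assumes "A \<in> carrier_mat m m" "B \<in> carrier_mat m m" "C \<in> carrier_mat m m"
  shows "hs_inner A (B + C) = hs_inner A B + hs_inner A C"
  using assms by (simp add: hs_inner_carrier algebra_simps sum.distrib)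

lemma hs_inner_smult_right:
  assumes "A \<in> carrier_mat m m" "B \<in> carrier_mat m m"
  shows "hs_inner A (c \<cdot>\<^sub>m B) = c * hs_inner A B"
  using assms by (simp add: hs_inner_carrier sum_distrib_left mult_ac)

lemma hs_inner_add_left:
  assumes "A \<in> carrier_mat m m" "B \<in> carrier_mat m m" "C \<in> carrier_mat m m"
  shows "hs_inner (A + B) C = hs_inner A C + hs_inner B C"
  using assms by (simp add: hs_inner_carrier[of _ m] algebra_simps sum.distrib)

lemma hs_inner_smult_left:
  assumes "A \<in> carrier_mat m m" "B \<in> carrier_mat m m"
  shows "hs_inner (c \<cdot>\<^sub>m A) B = cnj c * hs_inner A B"
  using assms by (simp add: hs_inner_carrier[of _ m] sum_distrib_left mult_ac)

lemma hs_inner_blocks: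
  assumes "A \<in> carrier_mat (k * n) (k * n)"
  shows "hs_inner A B = (\<Sum>i<k. \<Sum>j<k. hs_inner (block n A i j) (block n B i j))"
proof -
  define f where "f s t = cnj (A $$ (s, t)) * B $$ (s, t)" for s t
  have "hs_inner A B = (\<Sum>i<k. \<Sum>a<n. \<Sum>j<k. \<Sum>b<n. f (i * n + a) (j * n + b))"
    by (simp add: hs_inner_carrier[OF assms] f_def sum_pair_index)
  also have "\<dots> = (\<Sum>i<k. \<Sum>j<k. \<Sum>a<n. \<Sum>b<n. f (i * n + a) (j * n + b))"
    by (rule sum.cong[OF refl], rule sum.swap)
  also have "\<dots> = (\<Sum>i<k. \<Sum>j<k. hs_inner (block n A i j) (block n B i j))"
    by (simp add: hs_inner_carrier[OF block_carrier] f_def)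
  finally show ?thesis .
qed

text \<open>The formula is forced: pairing a matrix with the unit E_ij reads off its (i, j) entry,
  and the adjoint relation moves that unit under G.\<close>

definition hs_adj :: "nat \<Rightarrow> (complex mat \<Rightarrow> complex mat) \<Rightarrow> complex mat \<Rightarrow> complex mat" where
  "hs_adj m G B = mat m m (\<lambda>(i, j). hs_inner (G (mat_unit m i j)) B)"

lemma hs_adj_carrier [simp]: "hs_adj m G B \<in> carrier_mat m m"
  by (simp add: hs_adj_def)

lemma hs_adj_linear:
  assumes G: "mat_linear m n G"
  shows "mat_linear n m (hs_adj m G)"
proof -
  have c: "G (mat_unit m i j) \<in> carrier_mat n n" for i j
    using mat_semilinear_carrier[OF G mat_unit_carrier] .
  show ?thesis
    unfolding mat_semilinear_def
  proof (intro conjI ballI allI)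
    fix A B :: "complex mat" and c'
    assume A: "A \<in> carrier_mat n n"
    show "hs_adj m G (c' \<cdot>\<^sub>m A) = c' \<cdot>\<^sub>m hs_adj m G A"
      by (rule eq_matI) (simp_all add: hs_adj_def hs_inner_smult_right[OF c A])
    assume B: "B \<in> carrier_mat n n"
    show "hs_adj m G (A + B) = hs_adj m G A + hs_adj m G B"
      by (rule eq_matI) (simp_all add: hs_adj_def hs_inner_add_right[OF c A B])
  qed simp
qed

lemma hs_inner_hs_adj:
  assumes G: "mat_linear m n G" and A: "A \<in> carrier_mat m m" and B: "B \<in> carrier_mat n n"
  shows "hs_inner (G A) B = hs_inner A (hs_adj m G B)"
proof -
  note c = mat_semilinear_carrier[OF G]
  have "hs_inner (G A) B = (\<Sum>i<m. \<Sum>j<m. cnj (A $$ (i, j)) * hs_inner (G (mat_unit m i j)) B)"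
    \<comment> \<open>The product is conjugate-linear in its first argument, hence the twist
      \<open>cnj\<close>.\<close>
    by (rule functional_mat_unit_expansion[OF _ _ A, where \<sigma> = cnj])
      (simp_all add: mat_semilinear_add[OF G] mat_semilinear_smult[OF G] c B
        hs_inner_add_left[of _ n] hs_inner_smult_left[of _ n])
  also have "\<dots> = hs_inner A (hs_adj m G B)"
    by (simp add: hs_inner_carrier[OF A] hs_adj_def)
  finally show ?thesis .
qed

lemma hs_adjoint_lift:
  assumes G: "mat_linear m n G"
  shows "hs_adjoint [m] [n] (lift m G) = lift n (hs_adj m G)"
  unfolding hs_adjoint_def
proof (rule the_equality)
  have "mm_trace (mm_mult (mm_dagger (lift m G X)) Y) =
      mm_trace (mm_mult (mm_dagger X) (lift n (hs_adj m G) Y))"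
    if X: "X \<in> elems [m]" and Y: "Y \<in> elems [n]" for X Y
  proof -
    obtain A where A: "A \<in> carrier_mat m m" "X = [A]" using X unfolding mem_elems_single by blast
    obtain B where B: "B \<in> carrier_mat n n" "Y = [B]" using Y unfolding mem_elems_single by blast
    show ?thesis
      using A B mat_semilinear_carrier[OF G A(1)]
      by (simp add: trace_adjoint_mult[of _ n] trace_adjoint_mult[of _ m] hs_inner_hs_adj[OF G])
  qed
  then show "lift n (hs_adj m G) \<in> linear_maps [n] [m] \<and>
    (\<forall>A\<in>elems [m]. \<forall>B\<in>elems [n]. mm_trace (mm_mult (mm_dagger (lift m G A)) B) =
      mm_trace (mm_mult (mm_dagger A) (lift n (hs_adj m G) B)))"
    using lift_mem_semilinear_maps[OF hs_adj_linear[OF G]] by simp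
next
  fix \<Psi>
  assume \<Psi>: "\<Psi> \<in> linear_maps [n] [m] \<and>
    (\<forall>A\<in>elems [m]. \<forall>B\<in>elems [n]. mm_trace (mm_mult (mm_dagger (lift m G A)) B) =
      mm_trace (mm_mult (mm_dagger A) (\<Psi> B)))"
  then obtain H where H: "\<Psi> = lift n H" "mat_linear n m H"
    using semilinear_mapsE[of \<Psi> "\<lambda>c. c" n m] by auto
  have "H B = hs_adj m G B" if B: "B \<in> carrier_mat n n" for B
  proof (rule eq_matI)
    note HB = mat_semilinear_carrier[OF H(2) B]
    fix i j
    assume "i < dim_row (hs_adj m G B)" "j < dim_col (hs_adj m G B)"
    then have ij: "i < m" "j < m" by (auto simp: hs_adj_def)
    let ?E = "mat_unit m i j"
    \<comment> \<open>Testing a competing adjoint against a matrix unit yields each of its entries,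
      which gives uniqueness.\<close>
    have "mm_trace (mm_mult (mm_dagger (lift m G [?E])) [B]) = mm_trace (mm_mult (mm_dagger [?E]) (\<Psi> [B]))"
      using \<Psi> B by (simp del: mm_mult_single mm_dagger_single mm_trace_single lift_single)
    then have "hs_inner (G ?E) B = hs_inner ?E (H B)"
      using B HB mat_semilinear_carrier[OF G mat_unit_carrier]
      by (simp add: H(1) trace_adjoint_mult[of _ n] trace_adjoint_mult[of _ m])
    then show "H B $$ (i, j) = hs_adj m G B $$ (i, j)"
      using ij by (simp add: hs_adj_def hs_inner_mat_unit)
  qed (use mat_semilinear_carrier[OF H(2) B] in \<open>auto simp: hs_adj_def\<close>)
  then show "\<Psi> = lift n (hs_adj m G)" by (simp add: H(1) lift_eq_iff)
qed

text \<open>Taking adjoints commutes with ampliation, since the Hilbert--Schmidt product is the sum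
  of the products of corresponding blocks. Complete positivity of the adjoint rests on this.\<close>

lemma hs_inner_ampliation:
  assumes G: "mat_linear m n G" and X: "X \<in> carrier_mat (k * m) (k * m)"
  shows "hs_inner (ampliation k m n G X) Y = hs_inner X (ampliation k n m (hs_adj m G) Y)"
  by (simp add: hs_inner_blocks[OF ampliation_carrier] hs_inner_blocks[OF X]
      block_ampliation[OF G] block_ampliation[OF hs_adj_linear[OF G]] hs_inner_hs_adj[OF G])

section \<open>Channel states and time reversal\<close>

text \<open>The product of two tensor factors as a contraction: the column index of the first factor
  is identified with the row index of the second and summed over.\<close>

definition mult_mat :: "nat \<Rightarrow> complex mat \<Rightarrow> complex mat" where
  "mult_mat m X = mat m m (\<lambda>(i, j). \<Sum>p<m. X $$ (i * m + p, p * m + j))"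

lemma mult_mat_linear: "mat_linear (m * m) m (mult_mat m)"
  unfolding mat_semilinear_def
proof (intro conjI ballI allI)
  fix X Y :: "complex mat" and c
  assume X: "X \<in> carrier_mat (m * m) (m * m)"
  show "mult_mat m X \<in> carrier_mat m m" by (simp add: mult_mat_def)
  show "mult_mat m (c \<cdot>\<^sub>m X) = c \<cdot>\<^sub>m mult_mat m X"
    using X by (intro eq_matI) (simp_all add: mult_mat_def pair_index_less sum_distrib_left)
  assume Y: "Y \<in> carrier_mat (m * m) (m * m)"
  show "mult_mat m (X + Y) = mult_mat m X + mult_mat m Y"
    using X Y by (intro eq_matI) (simp_all add: mult_mat_def pair_index_less sum.distrib)
qed

lemma mult_mat_kronecker:
  assumes A: "A \<in> carrier_mat m m" and B: "B \<in> carrier_mat m m"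
  shows "mult_mat m (kronecker A B) = A * B"
proof (rule eq_matI)
  fix i j assume "i < dim_row (A * B)" "j < dim_col (A * B)"
  then have ij: "i < m" "j < m" using A B by auto
  have "kronecker A B $$ (i * m + p, p * m + j) = A $$ (i, p) * B $$ (p, j)" if "p < m" for p
    using ij that by (simp add: index_kronecker[OF A B] pair_index_less)
  then show "mult_mat m (kronecker A B) $$ (i, j) = (A * B) $$ (i, j)"
    using ij A B by (simp add: mult_mat_def scalar_prod_def atLeast0LessThan)
qed (use A B in \<open>auto simp: mult_mat_def\<close>)

lemma mult_map_single: "mult_map [m] = lift (m * m) (mult_mat m)"
  unfolding mult_map_def
  by (rule tensor_ext_eqI[OF mult_mat_linear]) (simp add: mult_mat_kronecker)

lemma mat_unit_mult:
  assumes "j < m"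
  shows "mat_unit m i j * mat_unit m k l = (if j = k then mat_unit m i l else 0\<^sub>m m m)"
proof (rule eq_matI)
  fix a b assume "a < dim_row (if j = k then mat_unit m i l else 0\<^sub>m m m)"
    "b < dim_col (if j = k then mat_unit m i l else 0\<^sub>m m m)"
  then have ab: "a < m" "b < m" by (auto simp: mat_unit_def split: if_splits)
  have "(mat_unit m i j * mat_unit m k l) $$ (a, b) =
      (\<Sum>p<m. mat_unit m i j $$ (a, p) * mat_unit m k l $$ (p, b))"
    using ab by (simp add: scalar_prod_def atLeast0LessThan mat_unit_def)
  also have "\<dots> = (\<Sum>p<m. if p = j then (if a = i \<and> j = k \<and> b = l then 1 else 0) else 0)"
    using ab by (intro sum.cong) auto
  also have "\<dots> = (if j = k then mat_unit m i l else 0\<^sub>m m m) $$ (a, b)"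
    using ab assms by auto
  finally show "(mat_unit m i j * mat_unit m k l) $$ (a, b) =
    (if j = k then mat_unit m i l else 0\<^sub>m m m) $$ (a, b)" .
qed (auto simp: mat_unit_def)

text \<open>The flip operator, that is, the sum of all E_ij \<otimes> E_ji.\<close>

definition swap_mat :: "nat \<Rightarrow> complex mat" where
  "swap_mat m = mat (m * m) (m * m)
     (\<lambda>(s, t). if s div m = t mod m \<and> s mod m = t div m then 1 else 0)"

lemma block_swap_mat:
  assumes "i < m" "j < m"
  shows "block m (swap_mat m) i j = mat_unit m j i"
  using assms by (intro eq_matI) (auto simp: block_def swap_mat_def mat_unit_def pair_index_less)

text \<open>The entry belonging to E_ij \<otimes> E_kl is the conjugate trace of E_ij E_kl, which is
  1 if j = k and i = l, and 0 otherwise.\<close>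

lemma hs_adj_mult_mat_one: "hs_adj (m * m) (mult_mat m) (1\<^sub>m m) = swap_mat m"
proof (rule block_eqI[of _ m m])
  fix i j assume ij: "i < m" "j < m"
  show "block m (hs_adj (m * m) (mult_mat m) (1\<^sub>m m)) i j = block m (swap_mat m) i j"
    unfolding block_swap_mat[OF ij]
  proof (rule eq_matI)
    fix k l assume "k < dim_row (mat_unit m j i)" "l < dim_col (mat_unit m j i)"
    then have kl: "k < m" "l < m" by (auto simp: mat_unit_def)
    have unit: "mat_unit (m * m) (i * m + k) (j * m + l) = kronecker (mat_unit m i j) (mat_unit m k l)"
      using mat_unit_eq_kronecker[of "i * m + k" m m "j * m + l"] ij kl by (simp add: pair_index_less)
    have "hs_adj (m * m) (mult_mat m) (1\<^sub>m m) $$ (i * m + k, j * m + l) =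
        hs_inner (mat_unit m i j * mat_unit m k l) (1\<^sub>m m)"
      using ij kl by (simp add: hs_adj_def pair_index_less unit mult_mat_kronecker)
    also have "\<dots> = (if j = k \<and> i = l then 1 else 0)"
    proof (cases "j = k")
      case True
      then show ?thesis using ij kl by (simp add: mat_unit_mult hs_inner_mat_unit)
    next
      case False
      then show ?thesis using ij by (simp add: mat_unit_mult hs_inner_def)
    qed
    finally show "block m (hs_adj (m * m) (mult_mat m) (1\<^sub>m m)) i j $$ (k, l) = mat_unit m j i $$ (k, l)"
      using kl by auto
  qed (auto simp: block_def mat_unit_def)
qed (auto simp: hs_adj_def swap_mat_def)

text \<open>The (i, j) block of this matrix is G(E_ji), so it is the Choi matrix of G with the units
  transposed in the first factor.\<close>

lemma channel_state_lift:
  assumes G: "mat_linear m n G"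
  shows "channel_state [m] [n] (lift m G) = [ampliation m m n G (swap_mat m)]"
proof -
  have "mult_map [m] = lift (m * m) (mult_mat m)" by (rule mult_map_single)
  moreover have "swap_mat m \<in> carrier_mat (m * m) (m * m)" by (simp add: swap_mat_def)
  ultimately show ?thesis
    by (simp add: channel_state_def hs_adjoint_lift[OF mult_mat_linear] hs_adj_mult_mat_one
        map_tensor_id_lift[OF G])
qed

text \<open>Conjugate transposition combined with the exchange of the two tensor factors: the entry
  at ((i,k),(j,l)) is the conjugate of the entry of X at ((l,j),(k,i)).\<close>

definition conj_flip :: "nat \<Rightarrow> nat \<Rightarrow> complex mat \<Rightarrow> complex mat" where
  "conj_flip n m X = mat (m * n) (m * n)
     (\<lambda>(s, t). cnj (X $$ ((t mod n) * m + t div n, (s mod n) * m + s div n)))"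

lemma conj_flip_carrier [simp]: "conj_flip n m X \<in> carrier_mat (m * n) (m * n)"
  by (simp add: conj_flip_def)

lemma index_block_conj_flip:
  assumes "i < m" "j < m" "k < n" "l < n"
  shows "block n (conj_flip n m X) i j $$ (k, l) = cnj (block m X l k $$ (j, i))"
  using assms by (simp add: conj_flip_def pair_index_less)

lemma conj_flip_semilinear: "mat_semilinear cnj (n * m) (m * n) (conj_flip n m)"
  unfolding mat_semilinear_def
proof (intro conjI ballI allI)
  fix X Y :: "complex mat" and c
  assume X: "X \<in> carrier_mat (n * m) (n * m)"
  show "conj_flip n m (c \<cdot>\<^sub>m X) = cnj c \<cdot>\<^sub>m conj_flip n m X"
  proof (rule block_eqI[of _ m n])
    fix i j assume "i < m" "j < m"
    then show "block n (conj_flip n m (c \<cdot>\<^sub>m X)) i j = block n (cnj c \<cdot>\<^sub>m conj_flip n m X) i j"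
      by (intro eq_matI)
        (simp_all add: index_block_conj_flip block_smult[of _ m] block_smult[OF X] carrier_matD[OF block_carrier]
          del: index_block)
  qed simp_all
  assume Y: "Y \<in> carrier_mat (n * m) (n * m)"
  show "conj_flip n m (X + Y) = conj_flip n m X + conj_flip n m Y"
  proof (rule block_eqI[of _ m n])
    fix i j assume "i < m" "j < m"
    then show "block n (conj_flip n m (X + Y)) i j = block n (conj_flip n m X + conj_flip n m Y) i j"
      by (intro eq_matI)
        (simp_all add: index_block_conj_flip block_add[of _ m] block_add[OF X Y] carrier_matD[OF block_carrier]
          del: index_block)
  qed simp_all
qed simp

lemma time_reversal_single: "time_reversal [n] [m] = lift (n * m) (conj_flip n m)"
  unfolding time_reversal_def alg_tensor_single
proof (rule tensor_ext_eqI[OF conj_flip_semilinear])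
  fix B A :: "complex mat"
  assume B: "B \<in> carrier_mat n n" and A: "A \<in> carrier_mat m m"
  have "conj_flip n m (kronecker B A) = kronecker (mat_adjoint A) (mat_adjoint B)"
  proof (rule block_eqI[of _ m n])
    fix i j assume "i < m" "j < m"
    then show "block n (conj_flip n m (kronecker B A)) i j =
        block n (kronecker (mat_adjoint A) (mat_adjoint B)) i j"
      using A B by (intro eq_matI)
        (simp_all add: index_block_conj_flip block_kronecker[OF B A] carrier_matD[OF block_carrier]
          block_kronecker[OF mat_adjoint_carrier[OF A] mat_adjoint_carrier[OF B]]
          carrier_matD[OF mat_adjoint_carrier[OF B]] del: index_block)
  qed (simp_all add: A B)
  then show "[conj_flip n m (kronecker B A)] = mm_tensor (mm_dagger [A]) (mm_dagger [B])" by simp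
qed

text \<open>The \<open>((i,k),(j,l))\<close> entries of the two sides are \<open>G(E\<^sub>j\<^sub>i)\<^sub>k\<^sub>l\<close> and the conjugate of
  \<open>H(E\<^sub>k\<^sub>l)\<^sub>j\<^sub>i\<close>.\<close>

lemma channel_state_time_reversal_iff:
  assumes G: "mat_linear m n G" and H: "mat_linear n m H"
  shows "channel_state [m] [n] (lift m G) = time_reversal [n] [m] (channel_state [n] [m] (lift n H)) \<longleftrightarrow>
    lift n H = lift n (hs_adj m G)"
proof -
  let ?D = "ampliation m m n G (swap_mat m)" and ?D' = "conj_flip n m (ampliation n n m H (swap_mat n))"
  have D: "block n ?D i j $$ (k, l) = cnj (hs_adj m G (mat_unit n k l) $$ (j, i))"
    and D': "block n ?D' i j $$ (k, l) = cnj (H (mat_unit n k l) $$ (j, i))"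
    if "i < m" "j < m" "k < n" "l < n" for i j k l
    using that mat_semilinear_carrier[OF G mat_unit_carrier]
    by (simp_all add: block_ampliation[OF G] block_ampliation[OF H] block_swap_mat index_block_conj_flip
        hs_adj_def hs_inner_mat_unit_right[of _ n] del: index_block)
  have "channel_state [m] [n] (lift m G) = time_reversal [n] [m] (channel_state [n] [m] (lift n H)) \<longleftrightarrow>
      ?D = ?D'"
    by (simp add: channel_state_lift[OF G] channel_state_lift[OF H] time_reversal_single)
  also have "\<dots> \<longleftrightarrow> (\<forall>k<n. \<forall>l<n. H (mat_unit n k l) = hs_adj m G (mat_unit n k l))"
  proof
    assume eq: "?D = ?D'"
    show "\<forall>k<n. \<forall>l<n. H (mat_unit n k l) = hs_adj m G (mat_unit n k l)"
    proof (intro allI impI eq_matI)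
      fix k l i j
      assume kl: "k < n" "l < n" and "i < dim_row (hs_adj m G (mat_unit n k l))" "j < dim_col (hs_adj m G (mat_unit n k l))"
      then have ij: "i < m" "j < m" by (auto simp: hs_adj_def)
      have "cnj (hs_adj m G (mat_unit n k l) $$ (i, j)) = cnj (H (mat_unit n k l) $$ (i, j))"
        \<comment> \<open>Entry (i, j) of the adjoint sits in block (j, i) of the channel state,
          hence the exchanged indices.\<close>
        using D[OF ij(2,1) kl] D'[OF ij(2,1) kl] eq by metis
      then show "H (mat_unit n k l) $$ (i, j) = hs_adj m G (mat_unit n k l) $$ (i, j)" by simp
    qed (use mat_semilinear_carrier[OF H mat_unit_carrier] in \<open>auto simp: hs_adj_def\<close>)
  next
    assume eq: "\<forall>k<n. \<forall>l<n. H (mat_unit n k l) = hs_adj m G (mat_unit n k l)"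
    show "?D = ?D'"
    proof (rule block_eqI[of _ m n])
      fix i j assume ij: "i < m" "j < m"
      show "block n ?D i j = block n ?D' i j"
        by (rule eq_matI) (simp_all add: D[OF ij] D'[OF ij] eq carrier_matD[OF block_carrier] del: index_block)
    qed simp_all
  qed
  also have "\<dots> \<longleftrightarrow> lift n H = lift n (hs_adj m G)"
    unfolding lift_eq_iff using mat_semilinear_eqI[OF H hs_adj_linear[OF G]] by auto
  finally show ?thesis .
qed

section \<open>Positivity and channels\<close>

lemma index_adjoint_mult:
  assumes "B \<in> carrier_mat d d" "i < d" "j < d"
  shows "(mat_adjoint B * B) $$ (i, j) = (\<Sum>k<d. cnj (B $$ (k, i)) * B $$ (k, j))"
  using assms by (simp add: scalar_prod_def atLeast0LessThan)

lemma psd_cong: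
  assumes "\<And>i j. i < d \<Longrightarrow> j < d \<Longrightarrow> X i j = Y i j"
  shows "psd d X \<longleftrightarrow> psd d Y"
  using assms by (simp add: psd_def quad_def)

lemma psd_adjoint_mult:
  assumes "B \<in> carrier_mat d d"
  shows "psd d (\<lambda>i j. (mat_adjoint B * B) $$ (i, j))"
  using psd_cong[OF index_adjoint_mult[OF assms]] gram_psd[where n=d and d=d and c="\<lambda>k i. B $$ (k, i)"]
  by simp

lemma psd_iff_adjoint_mult:
  assumes X: "X \<in> carrier_mat d d"
  shows "psd d (\<lambda>i j. X $$ (i, j)) \<longleftrightarrow> (\<exists>B\<in>carrier_mat d d. X = mat_adjoint B * B)"
proof
  assume "psd d (\<lambda>i j. X $$ (i, j))"
  then obtain c where c: "\<And>i j. i < d \<Longrightarrow> j < d \<Longrightarrow> X $$ (i, j) = (\<Sum>k<d. cnj (c k i) * c k j)"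
    using psd_imp_gram by blast
  define B where "B = mat d d (\<lambda>(k, i). c k i)"
  have B: "B \<in> carrier_mat d d" by (simp add: B_def)
  have "X = mat_adjoint B * B"
  proof (rule eq_matI)
    fix i j assume "i < dim_row (mat_adjoint B * B)" "j < dim_col (mat_adjoint B * B)"
    then have ij: "i < d" "j < d" using B by auto
    then show "X $$ (i, j) = (mat_adjoint B * B) $$ (i, j)"
      unfolding index_adjoint_mult[OF B ij] by (simp add: c B_def)
  qed (use X B in auto)
  then show "\<exists>B\<in>carrier_mat d d. X = mat_adjoint B * B" using B by blast
next
  assume "\<exists>B\<in>carrier_mat d d. X = mat_adjoint B * B"
  then show "psd d (\<lambda>i j. X $$ (i, j))" using psd_adjoint_mult by blast
qed

lemma mm_positive_single:
  assumes X: "X \<in> carrier_mat d d"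
  shows "mm_positive [d] [X] \<longleftrightarrow> psd d (\<lambda>i j. X $$ (i, j))"
  unfolding psd_iff_adjoint_mult[OF X] mm_positive_def bex_elems_single by simp

text \<open>Pairing X with a Gram matrix sums the quadratic form of X over the conjugated rows of C.
  Both directions of self-duality are read off from this.\<close>

lemma hs_inner_adjoint_mult:
  assumes C: "C \<in> carrier_mat d d"
  shows "hs_inner (mat_adjoint C * C) X = (\<Sum>k<d. quad d (\<lambda>i j. X $$ (i, j)) (\<lambda>i. cnj (C $$ (k, i))))"
proof -
  have CC: "mat_adjoint C * C \<in> carrier_mat d d" using C by auto
  have "hs_inner (mat_adjoint C * C) X =
      (\<Sum>i<d. \<Sum>j<d. \<Sum>k<d. C $$ (k, i) * X $$ (i, j) * cnj (C $$ (k, j)))"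
    unfolding hs_inner_carrier[OF CC]
    by (intro sum.cong refl) (simp add: index_adjoint_mult[OF C] sum_distrib_left sum_distrib_right mult_ac del: index_mult_mat)
  also have "\<dots> = (\<Sum>k<d. \<Sum>i<d. \<Sum>j<d. C $$ (k, i) * X $$ (i, j) * cnj (C $$ (k, j)))"
    by (subst (2) sum.swap, subst sum.swap) (rule refl)
  finally show ?thesis by (simp add: quad_def)
qed

lemma psd_iff_hs_inner:
  assumes "0 < d"
  shows "psd d (\<lambda>i j. X $$ (i, j)) \<longleftrightarrow> (\<forall>C\<in>carrier_mat d d. 0 \<le> hs_inner (mat_adjoint C * C) X)"
proof
  assume "psd d (\<lambda>i j. X $$ (i, j))"
  then show "\<forall>C\<in>carrier_mat d d. 0 \<le> hs_inner (mat_adjoint C * C) X"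
    by (auto simp: hs_inner_adjoint_mult psd_def intro!: sum_nonneg)
next
  assume pos: "\<forall>C\<in>carrier_mat d d. 0 \<le> hs_inner (mat_adjoint C * C) X"
  show "psd d (\<lambda>i j. X $$ (i, j))"
    unfolding psd_def
  proof
    fix w
    \<comment> \<open>With the conjugate of w in row 0 and zeros elsewhere, the sum over rows
      collapses to the form of X at w; \<open>0 < d\<close> guarantees that row 0 exists.\<close>
    define C where "C = mat d d (\<lambda>(k, i). if k = 0 then cnj (w i) else 0)"
    have C: "C \<in> carrier_mat d d" by (simp add: C_def)
    have "quad d (\<lambda>i j. X $$ (i, j)) (\<lambda>i. cnj (C $$ (k, i))) =
        (if k = 0 then quad d (\<lambda>i j. X $$ (i, j)) w else 0)" if "k < d" for k
      using that by (simp add: quad_def C_def)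
    then have "hs_inner (mat_adjoint C * C) X = quad d (\<lambda>i j. X $$ (i, j)) w"
      using assms by (simp add: hs_inner_adjoint_mult[OF C])
    then show "0 \<le> quad d (\<lambda>i j. X $$ (i, j)) w" using pos C by metis
  qed
qed

section \<open>The adjoint of a unital channel is a channel\<close>

lemma completely_positive_lift_iff:
  assumes G: "mat_linear m n G"
  shows "completely_positive [m] [n] (lift m G) \<longleftrightarrow>
    (\<forall>k>0. \<forall>X\<in>carrier_mat (k * m) (k * m). psd (k * m) (\<lambda>i j. X $$ (i, j)) \<longrightarrow>
      psd (k * n) (\<lambda>i j. ampliation k m n G X $$ (i, j)))"
  unfolding completely_positive_def alg_tensor_single map_tensor_id_lift[OF G] ball_elems_single
  by (simp add: mm_positive_single[OF ampliation_carrier] mm_positive_single)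

text \<open>By self-duality it suffices to pair the image of X with Gram matrices. The adjoint
  relation moves the ampliation of G onto the Gram matrix, where it preserves positivity, and two
  positive matrices have a nonnegative product.\<close>

lemma completely_positive_hs_adj:
  assumes G: "mat_linear m n G" and cp: "completely_positive [m] [n] (lift m G)" and "0 < m"
  shows "completely_positive [n] [m] (lift n (hs_adj m G))"
  unfolding completely_positive_lift_iff[OF hs_adj_linear[OF G]]
proof (intro allI impI ballI)
  fix k :: nat and X :: "complex mat"
  assume k: "0 < k" and X: "X \<in> carrier_mat (k * n) (k * n)" and psd: "psd (k * n) (\<lambda>i j. X $$ (i, j))"
  have km: "0 < k * m" using k \<open>0 < m\<close> by simp
  show "psd (k * m) (\<lambda>i j. ampliation k n m (hs_adj m G) X $$ (i, j))"
    unfolding psd_iff_hs_inner[OF km]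
  proof
    fix C :: "complex mat" assume C: "C \<in> carrier_mat (k * m) (k * m)"
    have CC: "mat_adjoint C * C \<in> carrier_mat (k * m) (k * m)" using C by auto
    have "psd (k * n) (\<lambda>i j. ampliation k m n G (mat_adjoint C * C) $$ (i, j))"
      using cp k CC psd_adjoint_mult[OF C] unfolding completely_positive_lift_iff[OF G] by blast
    \<comment> \<open>The positive image is factored again, so that its pairing with X becomes a sum
      of values of the form of X.\<close>
    then obtain D where D: "D \<in> carrier_mat (k * n) (k * n)"
        "ampliation k m n G (mat_adjoint C * C) = mat_adjoint D * D"
      unfolding psd_iff_adjoint_mult[OF ampliation_carrier] by blast
    have "0 \<le> hs_inner (mat_adjoint D * D) X"
      using psd by (auto simp: hs_inner_adjoint_mult[OF D(1)] psd_def intro!: sum_nonneg)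
    then show "0 \<le> hs_inner (mat_adjoint C * C) (ampliation k n m (hs_adj m G) X)"
      by (simp add: hs_inner_ampliation[OF G CC, symmetric] D(2))
  qed
qed

lemma CPTP_E:
  assumes "\<Phi> \<in> CPTP [m] [n]"
  obtains G where "\<Phi> = lift m G" "mat_linear m n G"
  using assms semilinear_mapsE[of \<Phi> "\<lambda>c. c" m n] by (auto simp: CPTP_def)

lemma mat_trace_one [simp]: "mat_trace (1\<^sub>m m) = of_nat m"
  by (simp add: mat_trace_def)

lemma hs_inner_one:
  assumes "A \<in> carrier_mat m m"
  shows "hs_inner (1\<^sub>m m) A = mat_trace A"
proof -
  have "(\<Sum>j<m. cnj (1\<^sub>m m $$ (i, j)) * A $$ (i, j)) = A $$ (i, i)" if "i < m" for i
  proof -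
    have "(\<Sum>j<m. cnj (1\<^sub>m m $$ (i, j)) * A $$ (i, j)) = (\<Sum>j<m. if j = i then A $$ (i, i) else 0)"
      using that by (intro sum.cong) auto
    then show ?thesis using that by simp
  qed
  then show ?thesis using assms by (simp add: hs_inner_carrier[OF one_carrier_mat] mat_trace_def)
qed

text \<open>The trace is the pairing with the unit, so moving G across turns unitality of G into
  trace preservation of the adjoint.\<close>

lemma hs_adj_CPTP:
  assumes G: "mat_linear m n G" and \<Phi>: "lift m G \<in> CPTP [m] [n]" and unital: "G (1\<^sub>m m) = 1\<^sub>m n"
    and "0 < m"
  shows "lift n (hs_adj m G) \<in> CPTP [n] [m]"
proof -
  have "mat_trace (hs_adj m G B) = mat_trace B" if B: "B \<in> carrier_mat n n" for B
    using hs_inner_hs_adj[OF G one_carrier_mat B] hs_inner_one[OF B] hs_inner_one[OF hs_adj_carrier]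
    by (simp add: unital)
  then have "trace_preserving [n] (lift n (hs_adj m G))"
    by (auto simp: trace_preserving_def mem_elems_single)
  moreover have "completely_positive [n] [m] (lift n (hs_adj m G))"
    using \<Phi> completely_positive_hs_adj[OF G _ \<open>0 < m\<close>] by (simp add: CPTP_def)
  ultimately show ?thesis
    using lift_mem_semilinear_maps[OF hs_adj_linear[OF G]] by (simp add: CPTP_def)
qed

section \<open>The uniform state and its Bayesian inverses\<close>

definition uniform :: "nat \<Rightarrow> elem" where
  "uniform m = mm_scale (1 / of_nat m) (mm_one [m])"

lemma uniform_state:
  assumes "0 < m"
  shows "uniform m \<in> states [m]"
proof -
  have "psd m (\<lambda>i j. (1 / of_nat m \<cdot>\<^sub>m 1\<^sub>m m) $$ (i, j))"
    unfolding psd_def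
  proof
    fix w
    have "(\<Sum>j<m. cnj (w i) * (1 / of_nat m \<cdot>\<^sub>m 1\<^sub>m m) $$ (i, j) * w j) = cnj (w i) * w i / of_nat m"
      if "i < m" for i
    proof -
      have "(\<Sum>j<m. cnj (w i) * (1 / of_nat m \<cdot>\<^sub>m 1\<^sub>m m) $$ (i, j) * w j) =
          (\<Sum>j<m. if j = i then cnj (w i) * w i / of_nat m else 0)"
        using that by (intro sum.cong) auto
      then show ?thesis using that by simp
    qed
    then have "quad m (\<lambda>i j. (1 / of_nat m \<cdot>\<^sub>m 1\<^sub>m m) $$ (i, j)) w = (\<Sum>i<m. cnj (w i) * w i / of_nat m)"
      by (simp add: quad_def)
    also have "0 \<le> \<dots>"
      by (rule sum_nonneg) (simp add: less_eq_complex_def)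
    finally show "0 \<le> quad m (\<lambda>i j. (1 / of_nat m \<cdot>\<^sub>m 1\<^sub>m m) $$ (i, j)) w" .
  qed
  moreover have "mat_trace (1 / of_nat m \<cdot>\<^sub>m 1\<^sub>m m) = 1"
    using assms by (simp add: mat_trace_def)
  ultimately show ?thesis
    by (simp add: states_def uniform_def mm_positive_single)
qed

lemma kronecker_one: "kronecker (c \<cdot>\<^sub>m 1\<^sub>m m) (1\<^sub>m n) = c \<cdot>\<^sub>m 1\<^sub>m (m * n)"
proof (rule block_eqI[of _ m n])
  fix i j assume "i < m" "j < m"
  then show "block n (kronecker (c \<cdot>\<^sub>m 1\<^sub>m m) (1\<^sub>m n)) i j = block n (c \<cdot>\<^sub>m 1\<^sub>m (m * n)) i j"
    by (intro eq_matI) (auto simp: block_def kronecker_def pair_index_less pair_index_eq_iff)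
qed simp_all

text \<open>The uniform state tensored with the unit is a scalar matrix and commutes with
  everything, so the premise of the axiom holds for every channel.\<close>

lemma classical_limit_uniform:
  assumes cl: "classical_limit star" and "0 < m" "0 < n" and \<Phi>: "\<Phi> \<in> CPTP [m] [n]"
  shows "star [m] [n] \<Phi> (uniform m) = mm_scale (1 / of_nat m) (channel_state [m] [n] \<Phi>)"
proof -
  obtain G where G: "\<Phi> = lift m G" "mat_linear m n G" using CPTP_E[OF \<Phi>] .
  define D where "D = ampliation m m n G (swap_mat m)"
  have D: "D \<in> carrier_mat (m * n) (m * n)" by (simp add: D_def)
  have cs: "channel_state [m] [n] \<Phi> = [D]"
    unfolding G(1) D_def by (rule channel_state_lift[OF G(2)])
  have right: "mm_mult (channel_state [m] [n] \<Phi>) (mm_tensor (uniform m) (mm_one [n])) =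
      mm_scale (1 / of_nat m) (channel_state [m] [n] \<Phi>)"
    using D by (simp add: cs uniform_def kronecker_one mult_smult_distrib[OF D one_carrier_mat])
  moreover have "mm_mult (mm_tensor (uniform m) (mm_one [n])) (channel_state [m] [n] \<Phi>) =
      mm_scale (1 / of_nat m) (channel_state [m] [n] \<Phi>)"
    using D by (simp add: cs uniform_def kronecker_one mult_smult_assoc_mat[OF one_carrier_mat D])
  ultimately show ?thesis
    using cl uniform_state[OF \<open>0 < m\<close>] \<Phi> \<open>0 < m\<close> \<open>0 < n\<close>
    unfolding classical_limit_def multi_matrix_def by auto
qed

lemma bayesian_inverse_uniform_iff:
  assumes cl: "classical_limit star" and m: "0 < m" and G: "mat_linear m m G"
    and \<Phi>: "lift m G \<in> CPTP [m] [m]" and unital: "G (1\<^sub>m m) = 1\<^sub>m m"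
  shows "bayesian_inverse star [m] [m] (lift m G) (uniform m) \<Psi> \<longleftrightarrow>
    \<Psi> \<in> CPTP [m] [m] \<and> \<Psi> = lift m (hs_adj m G)"
proof (cases "\<Psi> \<in> CPTP [m] [m]")
  case True
  then obtain H where H: "\<Psi> = lift m H" "mat_linear m m H" using CPTP_E by blast
  let ?c = "1 / of_nat m :: complex"
  \<comment> \<open>The candidate inverse is evaluated at the image state; since that state is again
    uniform, the preceding evaluation of \<open>star\<close> applies to both sides.\<close>
  have fixed: "lift m G (uniform m) = uniform m"
    using mat_semilinear_smult[OF G one_carrier_mat] by (simp add: uniform_def unital)
  define D where "D = ampliation m m m G (swap_mat m)"
  define D' where "D' = conj_flip m m (ampliation m m m H (swap_mat m))"
  have cs: "channel_state [m] [m] (lift m G) = [D]" "channel_state [m] [m] \<Psi> = [ampliation m m m H (swap_mat m)]"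
    unfolding D_def H(1) by (rule channel_state_lift[OF G], rule channel_state_lift[OF H(2)])
  have tau: "time_reversal [m] [m] (channel_state [m] [m] \<Psi>) = [D']"
    by (simp add: cs time_reversal_single D'_def)
  have "bayesian_inverse star [m] [m] (lift m G) (uniform m) \<Psi> \<longleftrightarrow>
      mm_scale ?c [D] = time_reversal [m] [m] (mm_scale ?c (channel_state [m] [m] \<Psi>))"
    using True by (simp only: bayesian_inverse_def fixed cs
        classical_limit_uniform[OF cl m m \<Phi>] classical_limit_uniform[OF cl m m True]) simp
  also have "\<dots> \<longleftrightarrow> ?c \<cdot>\<^sub>m D = ?c \<cdot>\<^sub>m D'"
    by (simp add: cs time_reversal_single D'_def mat_semilinear_smult[OF conj_flip_semilinear])
  also have "\<dots> \<longleftrightarrow> D = D'"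
  proof
    assume "?c \<cdot>\<^sub>m D = ?c \<cdot>\<^sub>m D'"
    \<comment> \<open>Multiplying by m, which is nonzero, cancels the common factor 1/m.\<close>
    moreover have "of_nat m \<cdot>\<^sub>m (?c \<cdot>\<^sub>m Z) = Z" for Z
      using m by (intro eq_matI) auto
    ultimately show "D = D'" by metis
  qed simp
  also have "\<dots> \<longleftrightarrow> channel_state [m] [m] (lift m G) = time_reversal [m] [m] (channel_state [m] [m] \<Psi>)"
    by (simp only: tau cs(1)) simp
  also have "\<dots> \<longleftrightarrow> \<Psi> = lift m (hs_adj m G)"
    unfolding H(1) by (rule channel_state_time_reversal_iff[OF G H(2)])
  finally show ?thesis using True by simp
qed (simp add: bayesian_inverse_def)

theorem mainTheorem3:
  fixes star :: sot and m n :: nat and \<E> :: "elem \<Rightarrow> elem" and \<rho> :: elem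
  assumes "state_over_time star"
    and "classical_limit star"
    and "0 < m" and "0 < n"
    and "\<E> \<in> CPTP [m] [n]"
    and "unital [m] [n] \<E>"
    and "\<rho> = mm_scale (1 / of_nat m) (mm_one [m])"
  shows "bayesian_inverse star [m] [n] \<E> \<rho> (hs_adjoint [m] [n] \<E>) \<and>
    (\<forall>\<Psi>. bayesian_inverse star [m] [n] \<E> \<rho> \<Psi> \<longrightarrow> \<Psi> = hs_adjoint [m] [n] \<E>)"
proof -
  obtain G where G: "\<E> = lift m G" "mat_linear m n G" using CPTP_E[OF assms(5)] .
  have one: "G (1\<^sub>m m) = 1\<^sub>m n" using assms(6) by (simp add: unital_def G(1))
  \<comment> \<open>By unitality the left side is the trace of the n by n unit, so trace
    preservation forces n = m.\<close>
  have "mm_trace (\<E> [1\<^sub>m m]) = mm_trace [1\<^sub>m m]"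
    using assms(5) unfolding CPTP_def trace_preserving_def by (simp del: mm_trace_single)
  then have nm: "n = m" by (simp add: G(1) one)
  have \<Phi>: "lift m G \<in> CPTP [m] [m]" and lin: "mat_linear m m G" and one': "G (1\<^sub>m m) = 1\<^sub>m m"
    using assms(5) G one unfolding nm by simp_all
  have adj: "hs_adjoint [m] [n] \<E> = lift m (hs_adj m G)"
    unfolding nm G(1) by (rule hs_adjoint_lift[OF lin])
  have "\<rho> = uniform m" using assms(7) by (simp add: uniform_def)
  then show ?thesis
    using bayesian_inverse_uniform_iff[OF assms(2,3) lin \<Phi> one'] hs_adj_CPTP[OF lin \<Phi> one' assms(3)]
    unfolding adj unfolding nm G(1) by simp
qed

end
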